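(* Let $\Gamma$ be an infinite, finitely generated amenable group with a finite symmetric generating set $S$, let $N$ be the spectral distribution of the Laplace operator of the uniform probability measure on $S$, and let $\mathrm{F\o l}$ be Følner's function of $\Gamma$ with respect to $S$. Let $F:(x_0,\infty)\to(0,\infty)$ be a continuous, strictly increasing function such that (1) $F(r)\to\infty$ as $r\to\infty$, (2) there is $C>1$ such that $F(r)^2\le F(Cr)$ for large $r>0$, (3) $F(r)\preceq\mathrm{F\o l}(r)$ near infinity. Then, near zero and in the dilatational sense, $$N(\lambda)\preceq\frac{1}{F\bigl(\lambda^{-1/2}\bigr)}.$$
   Context: Spectral distribution: for the uniform probability measure $\mu=\frac1{|S|}\sum_{s\in S}\delta_s$, let $R_\mu:l^2(\Gamma)\to l^2(\Gamma)$, $R_\mu(f)(x)=\sum_{\gamma}f(x\gamma^{-1})\mu(\gamma)$, and $\Delta=\mathrm{id}-R_\mu$. Then $N(\lambda)=\langle\chi_{(-\infty,\lambda]}(\Delta)\delta_e,\delta_e\rangle_{l^2(\Gamma)}$ for $\lambda\ge0$. Følner's function: $\mathrm{F\o l}:(0,\infty)\to\mathbb N$, $\mathrm{F\o l}(r)=\min\{|\Omega|:\ \Omega\subset\Gamma \text{ finite non-empty},\ |\partial_S\Omega|/|\Omega|<1/r\}$, where $\partial_S\Omega=\{x\in\Omega:\ \exists s\in S,\ xs\in\Gamma\setminus\Omega\}$. Asymptotic comparison: $f\preceq g$ near infinity means there are $C,D,x_1>0$ with $f(x)\le Cg(Dx)$ for all $x\ge x_1$. $f\preceq g$ near zero in the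 dilatational sense means there are $D,\epsilon>0$ with $f(\lambda)\le g(D\lambda)$ for all $\lambda\in[0,\epsilon)$; an expression defined only for small $\lambda>0$ (such as $1/F(\lambda^{-1/2})$) is given the value $0$ at $\lambda=0$. *)

theory Defs
  imports "HOL-Analysis.Analysis" "HOL-Algebra.Generated_Groups"
begin

subsection \<open>The Hilbert space of square-summable functions on a set\<close>

text \<open>Elements are total functions that vanish off the index set, so that equality of elements
  is equality of functions.\<close>

definition l2 :: "'a set \<Rightarrow> ('a \<Rightarrow> complex) set" where
  "l2 X = {f. (\<forall>x. x \<notin> X \<longrightarrow> f x = 0) \<and> (\<lambda>x. (cmod (f x))\<^sup>2) summable_on X}"

definition l2_inner :: "'a set \<Rightarrow> ('a \<Rightarrow> complex) \<Rightarrow> ('a \<Rightarrow> complex) \<Rightarrow> complex" where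
  "l2_inner X f g = (\<Sum>\<^sub>\<infinity>x\<in>X. f x * cnj (g x))"

definition l2_norm :: "'a set \<Rightarrow> ('a \<Rightarrow> complex) \<Rightarrow> real" where
  "l2_norm X f = sqrt (\<Sum>\<^sub>\<infinity>x\<in>X. (cmod (f x))\<^sup>2)"

definition l2_delta :: "'a \<Rightarrow> 'a \<Rightarrow> complex" where
  "l2_delta y = (\<lambda>x. if x = y then 1 else 0)"

definition l2_bounded_operator ::
    "'a set \<Rightarrow> (('a \<Rightarrow> complex) \<Rightarrow> ('a \<Rightarrow> complex)) \<Rightarrow> bool" where
  "l2_bounded_operator X T \<longleftrightarrow>
     T \<in> l2 X \<rightarrow>\<^sub>E l2 X \<and>
     (\<forall>f\<in>l2 X. \<forall>g\<in>l2 X. T (\<lambda>x. f x + g x) = (\<lambda>x. T f x + T g x)) \<and>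
     (\<forall>c. \<forall>f\<in>l2 X. T (\<lambda>x. c * f x) = (\<lambda>x. c * T f x)) \<and>
     (\<exists>M. \<forall>f\<in>l2 X. l2_norm X (T f) \<le> M * l2_norm X f)"

subsection \<open>Borel functional calculus of a bounded self-adjoint operator\<close>

text \<open>For a bounded self-adjoint operator \<open>A\<close> and a vector \<open>f\<close>, the spectral measure \<open>\<mu>\<^sub>f\<close> is
  the compactly supported finite Borel measure on the line with
  \<open>\<langle>p(A) f, f\<rangle> = \<integral> p d\<mu>\<^sub>f\<close> for all polynomials \<open>p\<close> (equivalently, by density, for all
  continuous \<open>p\<close>); by linearity it suffices to ask this for monomials. For a bounded Borel
  function \<open>h\<close>, the operator \<open>h(A)\<close> is then the bounded operator with
  \<open>\<langle>h(A) f, f\<rangle> = \<integral> h d\<mu>\<^sub>f\<close> for all \<open>f\<close>. It is unique since the scalars are complex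
  (polarization). For \<open>A\<close> not bounded self-adjoint, or \<open>h\<close> not bounded Borel, the definitions
  below carry no meaning.\<close>

definition l2_spectral_measure ::
    "'a set \<Rightarrow> (('a \<Rightarrow> complex) \<Rightarrow> ('a \<Rightarrow> complex)) \<Rightarrow> ('a \<Rightarrow> complex) \<Rightarrow> real measure" where
  "l2_spectral_measure X A f =
     (THE \<mu>. sets \<mu> = sets borel \<and> finite_measure \<mu> \<and> (\<exists>r. AE x in \<mu>. \<bar>x\<bar> \<le> r) \<and>
        (\<forall>n. l2_inner X ((A ^^ n) f) f = complex_of_real (\<integral>x. x ^ n \<partial>\<mu>)))"

definition l2_functional_calculus ::
    "'a set \<Rightarrow> (('a \<Rightarrow> complex) \<Rightarrow> ('a \<Rightarrow> complex)) \<Rightarrow> (real \<Rightarrow> complex) \<Rightarrow>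
     ('a \<Rightarrow> complex) \<Rightarrow> ('a \<Rightarrow> complex)" where
  "l2_functional_calculus X A h =
     (THE T. l2_bounded_operator X T \<and>
        (\<forall>f\<in>l2 X. l2_inner X (T f) f = (\<integral>x. h x \<partial>l2_spectral_measure X A f)))"

subsection \<open>Laplace operator and spectral distribution\<close>

definition uniform_weight :: "'a set \<Rightarrow> 'a \<Rightarrow> real" where
  "uniform_weight S \<gamma> = 1 / real (card S) * (\<Sum>s\<in>S. if \<gamma> = s then 1 else 0)"

definition right_convolution ::
    "('a, 'b) monoid_scheme \<Rightarrow> ('a \<Rightarrow> real) \<Rightarrow> ('a \<Rightarrow> complex) \<Rightarrow> ('a \<Rightarrow> complex)" where
  "right_convolution G \<mu> f =
     (\<lambda>x. if x \<in> carrier G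
          then \<Sum>\<^sub>\<infinity>\<gamma>\<in>carrier G. f (x \<otimes>\<^bsub>G\<^esub> inv\<^bsub>G\<^esub> \<gamma>) * complex_of_real (\<mu> \<gamma>)
          else 0)"

definition laplace_operator ::
    "('a, 'b) monoid_scheme \<Rightarrow> ('a \<Rightarrow> real) \<Rightarrow> ('a \<Rightarrow> complex) \<Rightarrow> ('a \<Rightarrow> complex)" where
  "laplace_operator G \<mu> f = (\<lambda>x. f x - right_convolution G \<mu> f x)"

text \<open>The inner product below is real because \<open>\<chi>\<^bsub>(-\<infinity>,\<lambda>]\<^esub>(\<Delta>)\<close> is self-adjoint.\<close>

definition spectral_distribution ::
    "('a, 'b) monoid_scheme \<Rightarrow> ('a \<Rightarrow> real) \<Rightarrow> real \<Rightarrow> real" where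
  "spectral_distribution G \<mu> lam =
     Re (l2_inner (carrier G)
           (l2_functional_calculus (carrier G) (laplace_operator G \<mu>) (indicator {..lam})
              (l2_delta \<one>\<^bsub>G\<^esub>))
           (l2_delta \<one>\<^bsub>G\<^esub>))"

subsection \<open>Amenability and the Folner function\<close>

definition amenable :: "('a, 'b) monoid_scheme \<Rightarrow> bool" where
  "amenable G \<longleftrightarrow>
     (\<exists>m :: 'a set \<Rightarrow> real.
        (\<forall>A. A \<subseteq> carrier G \<longrightarrow> 0 \<le> m A) \<and> m (carrier G) = 1 \<and>
        (\<forall>A B. A \<subseteq> carrier G \<longrightarrow> B \<subseteq> carrier G \<longrightarrow> A \<inter> B = {} \<longrightarrow> m (A \<union> B) = m A + m B) \<and>
        (\<forall>g\<in>carrier G. \<forall>A. A \<subseteq> carrier G \<longrightarrow> m (g <#\<^bsub>G\<^esub> A) = m A))"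

definition inner_boundary :: "('a, 'b) monoid_scheme \<Rightarrow> 'a set \<Rightarrow> 'a set \<Rightarrow> 'a set" where
  "inner_boundary G S \<Omega> = {x \<in> \<Omega>. \<exists>s\<in>S. x \<otimes>\<^bsub>G\<^esub> s \<in> carrier G - \<Omega>}"

definition folner :: "('a, 'b) monoid_scheme \<Rightarrow> 'a set \<Rightarrow> real \<Rightarrow> nat" where
  "folner G S r =
     (LEAST n. \<exists>\<Omega>. \<Omega> \<subseteq> carrier G \<and> finite \<Omega> \<and> \<Omega> \<noteq> {} \<and>
        real (card (inner_boundary G S \<Omega>)) / real (card \<Omega>) < 1 / r \<and> n = card \<Omega>)"

subsection \<open>Asymptotic comparison\<close>

text \<open>Functions defined only near infinity, or only near zero, are represented by total functions;
  values off the domain are irrelevant, because \<open>x\<^sub>1\<close> may be enlarged and \<open>\<epsilon>\<close> shrunk.\<close>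

definition preceq_at_infinity :: "(real \<Rightarrow> real) \<Rightarrow> (real \<Rightarrow> real) \<Rightarrow> bool" where
  "preceq_at_infinity f g \<longleftrightarrow>
     (\<exists>C>0. \<exists>D>0. \<exists>x\<^sub>1>0. \<forall>x\<ge>x\<^sub>1. f x \<le> C * g (D * x))"

definition dil_preceq_at_zero :: "(real \<Rightarrow> real) \<Rightarrow> (real \<Rightarrow> real) \<Rightarrow> bool" where
  "dil_preceq_at_zero f g \<longleftrightarrow>
     (\<exists>D>0. \<exists>\<epsilon>>0. \<forall>lam\<in>{0..<\<epsilon>}. f lam \<le> g (D * lam))"

end

theory Submission
  imports Defs "HOL-Probability.Helly_Selection" "HOL-Real_Asymp.Real_Asymp"
    "HOL-Computational_Algebra.Polynomial"
begin

text \<open>Let \<open>Q = 1 - \<Delta>/2\<close> be the lazy walk operator and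
  \<open>u\<^sub>n = \<parallel>Q\<^sup>n \<delta>\<^sub>e\<parallel>\<^sup>2 = \<integral> (1 - x/2)\<^bsup>2n\<^esup> d\<mu>\<close>, where \<open>\<mu>\<close> is the spectral measure of \<open>\<delta>\<^sub>e\<close>; hence
  \<open>(1 - \<lambda>/2)\<^bsup>2n\<^esup> N(\<lambda>) \<le> u\<^sub>n\<close>. The function \<open>Q\<^sup>n \<delta>\<^sub>e\<close> is a probability density, so cutting it off at
  height \<open>u\<^sub>n/4\<close> keeps half of its square mass on a set with at most \<open>4/u\<^sub>n\<close> elements. As long as
  \<open>4/u\<^sub>n < Fol(r)\<close>, Cheeger's inequality on that set gives \<open>u\<^bsub>n+1\<^esub> \<le> (1 - \<kappa>) u\<^sub>n\<close> with
  \<open>\<kappa> = 1 / (32 r\<^sup>2 |S|\<^sup>2)\<close>. Choosing \<open>r\<close> with \<open>\<kappa> = 4\<lambda>\<close> and \<open>n\<close> minimal with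
  \<open>exp(-\<kappa>n) \<le> 4/Fol(r)\<close> yields \<open>N(\<lambda>) \<le> 2 e\<^sup>2 Fol(r)\<^bsup>-1/2\<^esup>\<close>, and condition (2) on \<open>F\<close> absorbs the
  square root and the constants into a dilation.

  The spectral measure is obtained as a weak limit of binomial measures (Hausdorff's moment problem)
  and is unique by the Weierstrass theorem; the spectral projection is a strong limit of polynomials
  in \<open>\<Delta>\<close>.\<close>

subsection \<open>Moments of measures on a bounded interval\<close>

lemma polynomial_approx_on_interval:
  fixes g :: "real \<Rightarrow> real"
  assumes "continuous_on {-r..r} g" and "0 < e"
  shows "\<exists>p :: real poly. \<forall>x\<in>{-r..r}. \<bar>g x - poly p x\<bar> < e"
proof -
  obtain q where q: "real_polynomial_function q" "\<And>x. x \<in> {-r..r} \<Longrightarrow> \<bar>g x - q x\<bar> < e"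
    using Stone_Weierstrass_real_polynomial_function[OF compact_Icc assms] by blast
  from q(1) obtain a n where "q = (\<lambda>x. \<Sum>i\<le>n. a i * x ^ i)"
    unfolding real_polynomial_function_iff_sum by blast
  then have "q x = poly (\<Sum>i\<le>n. monom (a i) i) x" for x
    by (simp add: poly_sum poly_monom)
  with q(2) show ?thesis by metis
qed

text \<open>Weierstrass approximation of continuous ramps falling from 1 to 0 just to the right of
  \<open>a\<close>. The uniform bound 2 serves as the majorant in later uses of dominated
  convergence.\<close>

lemma indicator_polynomial_limit:
  fixes a r :: real
  shows "\<exists>p :: nat \<Rightarrow> real poly. \<forall>x\<in>{-r..r}.
     (\<forall>n. \<bar>poly (p n) x\<bar> \<le> 2) \<and> (\<lambda>n. poly (p n) x) \<longlonglongrightarrow> indicator {..a} x"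
proof -
  \<comment> \<open>For \<open>n > 0\<close> the ramp is 1 up to \<open>a\<close> and 0 from
    \<open>a + 1 / n\<close> on. Placing the slope to the right of \<open>a\<close> makes the limit
    the indicator of the closed half-line.\<close>
  define g where "g n x = min 1 (max 0 (1 - real n * (x - a)))" for n x
  have "\<exists>p :: real poly. \<forall>x\<in>{-r..r}. \<bar>g n x - poly p x\<bar> < 1 / real (Suc n)" for n
    by (rule polynomial_approx_on_interval) (auto simp: g_def intro!: continuous_intros)
  then obtain p :: "nat \<Rightarrow> real poly"
    where p: "\<And>n x. x \<in> {-r..r} \<Longrightarrow> \<bar>g n x - poly (p n) x\<bar> < 1 / real (Suc n)" by metis
  have g_lim: "(\<lambda>n. g n x) \<longlonglongrightarrow> indicator {..a} x" for x
  proof (cases "x \<le> a")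
    case True
    then have "real n * (x - a) \<le> 0" for n by (simp add: mult_nonneg_nonpos)
    then have "g n x = 1" for n unfolding g_def using \<open>\<And>n. real n * (x - a) \<le> 0\<close>[of n] by linarith
    with True show ?thesis by simp
  next
    case False
    have "\<forall>\<^sub>F n in sequentially. g n x = 0"
      using eventually_ge_at_top[of "nat \<lceil>1 / (x - a)\<rceil>"]
    proof eventually_elim
      case (elim n)
      then have "1 / (x - a) \<le> real n" by linarith
      with False show ?case by (simp add: g_def field_simps)
    qed
    with False show ?thesis by (simp add: tendsto_eventually)
  qed
  show ?thesis
  proof (intro exI[of _ p] ballI conjI allI)
    fix x n assume x: "x \<in> {-r..r}"
    have "\<bar>g n x\<bar> \<le> 1" by (simp add: g_def)
    moreover have "1 / real (Suc n) \<le> 1" by simp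
    ultimately show "\<bar>poly (p n) x\<bar> \<le> 2" using p[OF x, of n] by linarith
  next
    fix x assume x: "x \<in> {-r..r}"
    have "(\<lambda>n. g n x - poly (p n) x) \<longlonglongrightarrow> 0"
    proof (rule Lim_null_comparison)
      show "\<forall>\<^sub>F n in sequentially. norm (g n x - poly (p n) x) \<le> inverse (real (Suc n))"
        using p[OF x] by (intro always_eventually) (auto simp: field_simps intro: less_imp_le)
    qed (rule LIMSEQ_inverse_real_of_nat)
    from tendsto_diff[OF g_lim[of x] this] show "(\<lambda>n. poly (p n) x) \<longlonglongrightarrow> indicator {..a} x" by simp
  qed
qed

lemma integrable_poly:
  fixes M :: "real measure"
  assumes "finite_measure M" and sets: "sets M = sets borel" and AE: "AE x in M. \<bar>x\<bar> \<le> r"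
  shows "integrable M (poly p)"
proof -
  interpret finite_measure M by (rule assms(1))
  have "bounded (poly p ` {-r..r})"
    by (intro compact_imp_bounded compact_continuous_image) (auto intro!: continuous_intros)
  then obtain B where B: "\<And>x. \<bar>x\<bar> \<le> r \<Longrightarrow> norm (poly p x) \<le> B"
    unfolding bounded_iff by (force simp: abs_le_iff)
  have "poly p \<in> borel_measurable M"
    by (subst measurable_cong_sets[OF sets refl])
      (intro borel_measurable_continuous_onI continuous_intros)
  moreover have "AE x in M. norm (poly p x) \<le> B"
    using AE by eventually_elim (rule B)
  ultimately show ?thesis by (rule integrable_const_bound[rotated])
qed

lemma integral_poly:
  fixes M :: "real measure"
  assumes "finite_measure M" and "sets M = sets borel" and "AE x in M. \<bar>x\<bar> \<le> r"
  shows "(\<integral>x. poly p x \<partial>M) = (\<Sum>i\<le>degree p. coeff p i * (\<integral>x. x ^ i \<partial>M))"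
proof -
  have "integrable M (\<lambda>x. x ^ i)" for i
    using integrable_poly[OF assms, of "monom 1 i"] by (simp add: poly_monom[abs_def])
  then show ?thesis by (simp add: poly_altdef)
qed

text \<open>Equal moments give equal integrals of polynomials. Dominated convergence along
  polynomials tending to indicators carries this over to the distribution functions, which determine
  a finite Borel measure.\<close>

lemma moments_determine_measure:
  fixes M N :: "real measure"
  assumes M: "finite_measure M" "sets M = sets borel" "AE x in M. \<bar>x\<bar> \<le> r"
    and N: "finite_measure N" "sets N = sets borel" "AE x in N. \<bar>x\<bar> \<le> r'"
    and eq: "\<And>n. (\<integral>x. x ^ n \<partial>M) = (\<integral>x. x ^ n \<partial>N)"
  shows "M = N"
proof -
  define R where "R = max r r'"
  have AE: "AE x in M. x \<in> {-R..R}" "AE x in N. x \<in> {-R..R}"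
    using M(3) N(3) by (auto simp: R_def elim!: eventually_mono)
  have "measure M {..a} = measure N {..a}" for a
  proof -
    obtain p :: "nat \<Rightarrow> real poly"
      where p: "\<And>x n. x \<in> {-R..R} \<Longrightarrow> \<bar>poly (p n) x\<bar> \<le> 2"
        "\<And>x. x \<in> {-R..R} \<Longrightarrow> (\<lambda>n. poly (p n) x) \<longlonglongrightarrow> indicator {..a} x"
      using indicator_polynomial_limit[of R a] by blast
    have lim: "(\<lambda>n. \<integral>x. poly (p n) x \<partial>K) \<longlonglongrightarrow> measure K {..a}"
      if K: "finite_measure K" "sets K = sets borel" "AE x in K. x \<in> {-R..R}" for K
    proof -
      interpret finite_measure K by (rule K)
      have "(\<lambda>n. \<integral>x. poly (p n) x \<partial>K) \<longlonglongrightarrow> (\<integral>x. indicator {..a} x \<partial>K)"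
      proof (rule integral_dominated_convergence[where w = "\<lambda>_. 2"])
        show "(\<lambda>x. poly (p n) x) \<in> borel_measurable K" for n
          by (subst measurable_cong_sets[OF K(2) refl])
             (intro borel_measurable_continuous_onI continuous_intros)
        show "AE x in K. (\<lambda>n. poly (p n) x) \<longlonglongrightarrow> indicator {..a} x"
          using K(3) by eventually_elim (rule p(2))
        show "AE x in K. norm (poly (p n) x) \<le> 2" for n
          using K(3) by eventually_elim (use p(1) in simp)
      qed (use K(2) in \<open>auto simp: sets_eq_imp_space_eq[OF K(2)]\<close>)
      then show ?thesis using K(2) sets_eq_imp_space_eq[OF K(2)] by simp
    qed
    have "(\<integral>x. poly q x \<partial>M) = (\<integral>x. poly q x \<partial>N)" for q
      by (simp add: integral_poly[OF M] integral_poly[OF N] eq)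
    with lim[OF M(1,2) AE(1)] lim[OF N(1,2) AE(2)] show ?thesis
      by (simp add: LIMSEQ_unique)
  qed
  then have "cdf M = cdf N" by (simp add: cdf_def fun_eq_iff)
  moreover have "finite_borel_measure M" "finite_borel_measure N"
    using M N by (simp_all add: finite_borel_measure_def finite_borel_measure_axioms_def)
  ultimately show ?thesis using cdf_unique' by blast
qed

section \<open>The Hausdorff moment problem on the unit interval\<close>

lemma choose_ratio_eq_prod:
  assumes "n \<le> N"
  shows "real (k choose n) / real (N choose n) = (\<Prod>i<n. (real k - real i) / (real N - real i))"
proof -
  have "real (m choose n) = (\<Prod>i<n. real m - real i) / fact n" for m
    by (simp add: binomial_gbinomial gbinomial_prod_rev atLeast0LessThan)
  then show ?thesis by (simp add: prod_dividef)
qed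

text \<open>Both quantities are products of \<open>n\<close> factors of absolute value at most 1, so
  they differ by at most the sum of the differences of the factors. The bound is uniform in
  \<open>k\<close> and tends to 0 as \<open>N\<close> grows.\<close>

lemma choose_ratio_power_diff:
  assumes "k \<le> N" and "2 * n < N"
  shows "\<bar>real (k choose n) / real (N choose n) - (real k / real N) ^ n\<bar>
           \<le> real n * (real n / (real N - real n))"
proof -
  have bound: "\<bar>(real k - real i) / (real N - real i)\<bar> \<le> 1"
    "\<bar>(real k - real i) / (real N - real i) - real k / real N\<bar> \<le> real n / (real N - real n)"
    if "i < n" for i
  proof -
    have pos: "0 < real N - real i" "0 < real N" "0 < real N - real n" "real n < real N - real i"
      using that assms by linarith+
    \<comment> \<open>For \<open>k < i\<close> the numerator is negative; \<open>2 * n < N\<close>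
      keeps its absolute value below the denominator.\<close>
    have "\<bar>real k - real i\<bar> \<le> real N - real i" using that assms by (simp add: abs_le_iff)
    then show "\<bar>(real k - real i) / (real N - real i)\<bar> \<le> 1" using pos by simp
    have "(real k - real i) / (real N - real i) - real k / real N
            = - (real i * ((real N - real k) / real N) / (real N - real i))"
      using pos by (simp add: field_simps)
    also have "\<bar>\<dots>\<bar> = real i * ((real N - real k) / real N) / (real N - real i)"
      using pos assms by (simp add: abs_mult)
    also have "\<dots> \<le> real n / (real N - real n)"
    proof (rule frac_le)
      have "(real N - real k) / real N \<le> 1" using pos by simp
      with that show "real i * ((real N - real k) / real N) \<le> real n"
        using mult_mono[of "real i" "real n" "(real N - real k) / real N" 1] pos assms by simp
    qed (use that pos in auto)
    finally show "\<bar>(real k - real i) / (real N - real i) - real k / real N\<bar>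
        \<le> real n / (real N - real n)" .
  qed
  have "\<bar>(\<Prod>i<n. (real k - real i) / (real N - real i)) - (\<Prod>i<n. real k / real N)\<bar>
      \<le> (\<Sum>i<n. \<bar>(real k - real i) / (real N - real i) - real k / real N\<bar>)"
    using norm_prod_diff[of "{..<n}" "\<lambda>i. (real k - real i) / (real N - real i)"
        "\<lambda>i. real k / real N"] bound(1) assms by simp
  also have "\<dots> \<le> (\<Sum>i<n. real n / (real N - real n))"
    by (intro sum_mono bound(2)) simp
  finally show ?thesis
    using assms by (simp add: choose_ratio_eq_prod)
qed

text \<open>A homogeneous form of the factorial moments of the binomial distribution: absorb
  \<open>k choose n\<close> into \<open>N choose k\<close>, then apply the binomial theorem. Working
  over a commutative ring lets \<open>x\<close> and \<open>y\<close> be polynomials.\<close>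

lemma weighted_binomial_sum:
  fixes x y :: "'c::comm_ring_1"
  assumes "n \<le> N"
  shows "(\<Sum>k\<le>N. of_nat ((k choose n) * (N choose k)) * (x ^ k * y ^ (N - k)))
           = of_nat (N choose n) * (x ^ n * (x + y) ^ (N - n))"
proof -
  have "(\<Sum>k\<le>N. of_nat ((k choose n) * (N choose k)) * (x ^ k * y ^ (N - k)))
      = (\<Sum>k\<in>{n..N}. of_nat ((k choose n) * (N choose k)) * (x ^ k * y ^ (N - k)))"
    by (rule sum.mono_neutral_right) (auto simp: binomial_eq_0)
  also have "\<dots> = (\<Sum>j\<le>N - n. of_nat (((j + n) choose n) * (N choose (j + n)))
                     * (x ^ (j + n) * y ^ (N - (j + n))))"
    by (rule sum.reindex_bij_witness[of _ "\<lambda>j. j + n" "\<lambda>k. k - n"]) (use assms in auto)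
  also have "\<dots> = (\<Sum>j\<le>N - n. of_nat (N choose n) * (x ^ n *
                     (of_nat ((N - n) choose j) * x ^ j * y ^ (N - n - j))))"
  proof (rule sum.cong[OF refl])
    fix j assume "j \<in> {..N - n}"
    then have "((j + n) choose n) * (N choose (j + n)) = (N choose n) * ((N - n) choose j)"
      using choose_mult[of n "j + n" N] assms by (simp add: mult.commute)
    then show "of_nat (((j + n) choose n) * (N choose (j + n))) * (x ^ (j + n) * y ^ (N - (j + n)))
        = of_nat (N choose n) * (x ^ n * (of_nat ((N - n) choose j) * x ^ j * y ^ (N - n - j)))"
      by (simp add: power_add mult_ac diff_diff_add add.commute)
  qed
  also have "\<dots> = of_nat (N choose n) * (x ^ n * (x + y) ^ (N - n))"
    by (simp add: binomial_ring sum_distrib_left)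
  finally show ?thesis .
qed

text \<open>Positivity of \<open>L\<close> on Bernstein polynomials defines probability weights on
  the points \<open>k / N\<close>. The \<open>n\<close>-th moments of these measures approach
  \<open>L (monom 1 n)\<close>, since \<open>L\<close> gives the exact average of
  \<open>(k choose n) / (N choose n)\<close>, which is close to \<open>(k / N) ^ n\<close>. A weak
  limit then has the required moments.\<close>

lemma hausdorff_moment_problem:
  fixes L :: "real poly \<Rightarrow> real"
  assumes add: "\<And>p q. L (p + q) = L p + L q" and smult: "\<And>c p. L (smult c p) = c * L p"
    and pos: "\<And>k l. 0 \<le> L ([:0, 1:] ^ k * [:1, -1:] ^ l)" and one: "L 1 = 1"
  obtains M where "real_distribution M" and "AE x in M. x \<in> {0..1}"
    and "\<And>n. (\<integral>x. x ^ n \<partial>M) = L (monom 1 n)"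
proof -
  have L0: "L 0 = 0" using smult[of 0 0] by simp
  have L_sum: "L (sum p I) = (\<Sum>i\<in>I. L (p i))" for p and I :: "nat set"
    by (induction I rule: infinite_finite_induct) (simp_all add: L0 add)
  have L_of_nat: "L (of_nat c * p) = real c * L p" for c p
    using smult[of "real c" p] by (simp add: of_nat_poly)
  \<comment> \<open>The value of \<open>L\<close> at the \<open>k\<close>-th Bernstein polynomial of
    degree \<open>N\<close>.\<close>
  define w where "w N k = real (N choose k) * L ([:0, 1:] ^ k * [:1, -1:] ^ (N - k))" for N k
  have w_nonneg: "0 \<le> w N k" for N k by (simp add: w_def pos)
  have w_choose: "(\<Sum>k\<le>N. real (k choose n) * w N k) = real (N choose n) * L (monom 1 n)"
    if "n \<le> N" for n N
  proof -
    have "real (k choose n) * w N k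
        = L (of_nat ((k choose n) * (N choose k)) * ([:0, 1:] ^ k * [:1, -1:] ^ (N - k)))" for k
      unfolding L_of_nat w_def by simp
    then have "(\<Sum>k\<le>N. real (k choose n) * w N k)
        = L (of_nat (N choose n) * ([:0, 1:] ^ n * ([:0, 1:] + [:1, -1:]) ^ (N - n)))"
      by (simp only: L_sum[symmetric] weighted_binomial_sum[OF that])
    also have "[:0, 1:] + [:1, -1:] = (1 :: real poly)" by (simp add: one_pCons)
    finally show ?thesis by (simp only: L_of_nat power_one mult_1_right monom_altdef smult_1_left)
  qed
  have w_sum: "(\<Sum>k\<le>N. w N k) = 1" for N
    using w_choose[of 0 N] one by (simp add: monom_0 one_pCons)
  define P where "P N = point_measure {..N} (\<lambda>k. ennreal (w N k))" for N
  define \<mu> where "\<mu> N = distr (P N) borel (\<lambda>k. real k / real N)" for N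
  have space_P: "space (P N) = {..N}" for N by (simp add: P_def space_point_measure)
  have meas_P: "f \<in> measurable (P N) borel" for f :: "nat \<Rightarrow> real" and N
    by (simp add: P_def)
  have prob_P: "prob_space (P N)" for N
  proof
    have "emeasure (P N) (space (P N)) = (\<Sum>k\<le>N. ennreal (w N k))"
      unfolding space_P by (simp add: P_def emeasure_point_measure_finite)
    also have "\<dots> = 1" by (simp add: sum_ennreal w_nonneg w_sum)
    finally show "emeasure (P N) (space (P N)) = 1" .
  qed
  have real_distribution_\<mu>: "real_distribution (\<mu> N)" for N
    unfolding real_distribution_def real_distribution_axioms_def \<mu>_def
    using prob_space.prob_space_distr[OF prob_P meas_P] by auto
  have integral_\<mu>: "(\<integral>x. g x \<partial>\<mu> N) = (\<Sum>k\<le>N. w N k * g (real k / real N))"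
    if "g \<in> borel_measurable borel" for g :: "real \<Rightarrow> real" and N
    unfolding \<mu>_def integral_distr[OF meas_P that]
    by (simp add: P_def lebesgue_integral_point_measure_finite w_nonneg)
  \<comment> \<open>This includes \<open>N = 0\<close>, where the quotient is 0 by
    convention.\<close>
  have kN: "real k / real N \<in> {0..1}" if "k \<le> N" for k N
    using that by (auto simp: divide_le_eq_1)
  \<comment> \<open>All the measures live on the unit interval, so one half-open interval carries
    full mass for every \<open>N\<close>.\<close>
  have "tight \<mu>"
    unfolding tight_def
  proof (intro conjI allI impI real_distribution_\<mu>)
    fix \<epsilon> :: real assume \<epsilon>: "0 < \<epsilon>"
    have "measure (\<mu> N) {-1<..1} = 1" for N
    proof -
      have "measure (\<mu> N) {-1<..1} = measure (P N) ((\<lambda>k. real k / real N) -` {-1<..1} \<inter> space (P N))"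
        unfolding \<mu>_def by (rule measure_distr[OF meas_P]) simp
      also have "(\<lambda>k. real k / real N) -` {-1<..1} \<inter> space (P N) = space (P N)"
        unfolding space_P using kN[of _ N] by (force simp: less_le_trans[of "-1" 0])
      finally show ?thesis using prob_space.prob_space[OF prob_P] by simp
    qed
    then have "\<forall>N. 1 - \<epsilon> < measure (\<mu> N) {-1<..1}" using \<epsilon> by simp
    then show "\<exists>a b. a < b \<and> (\<forall>N. 1 - \<epsilon> < measure (\<mu> N) {a<..b})"
      by (intro exI[of _ "-1"] exI[of _ 1]) simp
  qed
  from tight_imp_convergent_subsubsequence[OF this strict_mono_id]
  obtain s M where s: "strict_mono (s :: nat \<Rightarrow> nat)" and M: "real_distribution M"
    and weak: "weak_conv_m (\<lambda>n. \<mu> (s n)) M" by (auto simp: comp_def id_def)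
  interpret M: real_distribution M by (rule M)
  have lim: "(\<lambda>n. \<integral>x. g x \<partial>\<mu> (s n)) \<longlonglongrightarrow> (\<integral>x. g x \<partial>M)"
    if "continuous_on UNIV g" "\<And>x. \<bar>g x\<bar> \<le> 1" for g :: "real \<Rightarrow> real"
    using weak_conv_imp_integral_bdd_continuous_conv[OF real_distribution_\<mu> M weak, of g 1] that
    by (simp add: continuous_on_eq_continuous_at)
  \<comment> \<open>Weak convergence only tests bounded continuous functions. Clamping to the unit
    interval makes powers bounded without changing them where the measures live.\<close>
  define cl :: "real \<Rightarrow> real" where "cl x = min 1 (max 0 x)" for x
  have cont_cl: "continuous_on UNIV cl"
    unfolding cl_def by (intro continuous_intros)
  have cl_le: "0 \<le> cl x" "cl x \<le> 1" for x by (simp_all add: cl_def)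
  have cl_id: "x \<in> {0..1} \<Longrightarrow> cl x = x" for x by (simp add: cl_def)
  \<comment> \<open>A bounded continuous function vanishing exactly on the unit interval: its
    integrals against all \<open>\<mu> N\<close> are 0, hence also the one against \<open>M\<close>,
    which confines \<open>M\<close> to that interval.\<close>
  define d where "d x = min 1 \<bar>x - cl x\<bar>" for x
  have cont_d: "continuous_on UNIV d"
    unfolding d_def by (intro continuous_intros cont_cl)
  have meas_d: "d \<in> borel_measurable borel" "d \<in> borel_measurable M"
    using borel_measurable_continuous_onI[OF cont_d] measurable_cong_sets[OF M.events_eq_borel refl]
    by auto
  have d_le: "0 \<le> d x" "\<bar>d x\<bar> \<le> 1" for x by (simp_all add: d_def)
  have "(\<integral>x. d x \<partial>\<mu> N) = 0" for N
    unfolding integral_\<mu>[OF meas_d(1)]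
    by (rule sum.neutral) (auto simp: d_def cl_id[OF kN])
  with lim[OF cont_d d_le(2)] have "(\<integral>x. d x \<partial>M) = 0"
    by (simp add: LIMSEQ_const_iff)
  moreover have "integrable M d"
    by (rule M.integrable_const_bound[of _ 1]) (use d_le meas_d in auto)
  ultimately have "AE x in M. d x = 0"
    using d_le by (subst (asm) integral_nonneg_eq_0_iff_AE) auto
  then have AE: "AE x in M. x \<in> {0..1}"
    by eventually_elim (auto simp: d_def cl_def min_def max_def split: if_splits)
  have moments: "(\<integral>x. x ^ n \<partial>M) = L (monom 1 n)" for n
  proof -
    have "(\<lambda>m. \<integral>x. cl x ^ n \<partial>\<mu> (s m)) \<longlonglongrightarrow> (\<integral>x. cl x ^ n \<partial>M)"
      by (rule lim) (use cl_le in \<open>auto intro!: continuous_intros cont_cl power_le_one\<close>)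
    also have "(\<integral>x. cl x ^ n \<partial>M) = (\<integral>x. x ^ n \<partial>M)"
    proof (rule integral_cong_AE)
      show "AE x in M. cl x ^ n = x ^ n" using AE by eventually_elim (simp only: cl_id)
    qed (subst measurable_cong_sets[OF M.events_eq_borel refl],
         intro borel_measurable_continuous_onI continuous_intros cont_cl)+
    finally have lim1: "(\<lambda>m. \<integral>x. cl x ^ n \<partial>\<mu> (s m)) \<longlonglongrightarrow> (\<integral>x. x ^ n \<partial>M)" .
    have "(\<lambda>N. (\<integral>x. cl x ^ n \<partial>\<mu> N) - L (monom 1 n)) \<longlonglongrightarrow> 0"
    proof (rule Lim_null_comparison)
      show "(\<lambda>N. real n * (real n / (real N - real n))) \<longlonglongrightarrow> 0" by real_asymp
      show "\<forall>\<^sub>F N in sequentially. norm ((\<integral>x. cl x ^ n \<partial>\<mu> N) - L (monom 1 n))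
              \<le> real n * (real n / (real N - real n))"
        using eventually_gt_at_top[of "2 * n"]
      proof eventually_elim
        case (elim N)
        then have nN: "n \<le> N" and "N choose n \<noteq> 0" by simp_all
        then have L_eq: "L (monom 1 n) = (\<Sum>k\<le>N. w N k * (real (k choose n) / real (N choose n)))"
          using w_choose[OF nN]
          by (simp add: sum_divide_distrib[symmetric] mult.commute)
        have "(\<integral>x. cl x ^ n \<partial>\<mu> N) = (\<Sum>k\<le>N. w N k * cl (real k / real N) ^ n)"
          by (rule integral_\<mu>) (intro borel_measurable_continuous_onI continuous_intros cont_cl)
        also have "\<dots> = (\<Sum>k\<le>N. w N k * (real k / real N) ^ n)"
          by (rule sum.cong) (use cl_id[OF kN] in auto)
        finally have "\<bar>(\<integral>x. cl x ^ n \<partial>\<mu> N) - L (monom 1 n)\<bar> = 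
            \<bar>\<Sum>k\<le>N. w N k * ((real k / real N) ^ n - real (k choose n) / real (N choose n))\<bar>"
          unfolding L_eq by (simp add: sum_subtractf right_diff_distrib)
        also have "\<dots> \<le> (\<Sum>k\<le>N. w N k * \<bar>(real k / real N) ^ n - real (k choose n) / real (N choose n)\<bar>)"
          by (rule order_trans[OF sum_abs]) (simp add: abs_mult w_nonneg)
        also have "\<dots> \<le> (\<Sum>k\<le>N. w N k * (real n * (real n / (real N - real n))))"
          using choose_ratio_power_diff[of _ N n] elim
          by (intro sum_mono mult_left_mono) (auto simp: w_nonneg abs_minus_commute)
        also have "\<dots> = real n * (real n / (real N - real n))"
          by (simp only: sum_distrib_right[symmetric] w_sum mult_1_left)
        finally show ?case by simp
      qed
    qed
    then have "(\<lambda>m. (\<integral>x. cl x ^ n \<partial>\<mu> (s m)) - L (monom 1 n)) \<longlonglongrightarrow> 0"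
      using LIMSEQ_subseq_LIMSEQ[OF _ s] by (force simp: comp_def)
    then have "(\<lambda>m. \<integral>x. cl x ^ n \<partial>\<mu> (s m)) \<longlonglongrightarrow> L (monom 1 n)"
      by (simp add: LIM_zero_iff)
    with lim1 show ?thesis by (rule LIMSEQ_unique)
  qed
  show ?thesis by (rule that[OF M AE moments])
qed

subsection \<open>The space of square-summable functions\<close>

lemma l2_zero: "(\<lambda>x. 0) \<in> l2 X" by (simp add: l2_def)

lemma l2_summable: "f \<in> l2 X \<Longrightarrow> (\<lambda>x. (cmod (f x))\<^sup>2) summable_on X"
  by (simp add: l2_def)

lemma l2_outside: "f \<in> l2 X \<Longrightarrow> x \<notin> X \<Longrightarrow> f x = 0"
  by (simp add: l2_def)

lemma l2_scale:
  assumes "f \<in> l2 X" shows "(\<lambda>x. c * f x) \<in> l2 X"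
  using assms summable_on_cmult_right[OF l2_summable[OF assms], of "(cmod c)\<^sup>2"]
  by (simp add: l2_def norm_mult power_mult_distrib)

lemma l2_add:
  assumes f: "f \<in> l2 X" and g: "g \<in> l2 X" shows "(\<lambda>x. f x + g x) \<in> l2 X"
proof -
  have bound: "(cmod (f x + g x))\<^sup>2 \<le> 2 * (cmod (f x))\<^sup>2 + 2 * (cmod (g x))\<^sup>2" for x
  proof -
    have "(cmod (f x + g x))\<^sup>2 \<le> (cmod (f x) + cmod (g x))\<^sup>2"
      by (intro power_mono norm_triangle_ineq) simp
    also have "\<dots> \<le> 2 * (cmod (f x))\<^sup>2 + 2 * (cmod (g x))\<^sup>2"
      using sum_squares_ge_zero[of "cmod (f x) - cmod (g x)" 0]
      by (simp add: power2_eq_square algebra_simps)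
    finally show ?thesis .
  qed
  have "(\<lambda>x. (cmod (f x + g x))\<^sup>2) summable_on X"
    by (rule summable_on_comparison_test[OF summable_on_add[OF
          summable_on_cmult_right[OF l2_summable[OF f], of 2]
          summable_on_cmult_right[OF l2_summable[OF g], of 2]]])
       (use bound in auto)
  with f g show ?thesis by (simp add: l2_def)
qed

lemma l2_diff: "f \<in> l2 X \<Longrightarrow> g \<in> l2 X \<Longrightarrow> (\<lambda>x. f x - g x) \<in> l2 X"
  using l2_add[of f X "\<lambda>x. (-1) * g x"] l2_scale[of g X "-1"] by simp

lemma l2_sum: "(\<And>i. i \<in> I \<Longrightarrow> f i \<in> l2 X) \<Longrightarrow> (\<lambda>x. \<Sum>i\<in>I. f i x) \<in> l2 X"
  by (induction I rule: infinite_finite_induct) (auto simp: l2_zero intro: l2_add)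

lemma l2_finite_support:
  assumes "finite A" and "A \<subseteq> X" and "\<And>x. x \<notin> A \<Longrightarrow> f x = 0"
  shows "f \<in> l2 X"
proof -
  have "(\<lambda>x. (cmod (f x))\<^sup>2) summable_on X"
    by (rule finite_nonzero_values_imp_summable_on, rule finite_subset[OF _ assms(1)])
       (use assms(3) in force)
  with assms show ?thesis by (auto simp: l2_def)
qed

lemma l2_delta_in_l2: "y \<in> X \<Longrightarrow> l2_delta y \<in> l2 X"
  by (rule l2_finite_support[of "{y}"]) (auto simp: l2_delta_def)

lemma l2_norm_sq: "(l2_norm X f)\<^sup>2 = (\<Sum>\<^sub>\<infinity>x\<in>X. (cmod (f x))\<^sup>2)"
  by (simp add: l2_norm_def infsum_nonneg)

lemma l2_norm_nonneg: "0 \<le> l2_norm X f"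
  by (simp add: l2_norm_def infsum_nonneg)

lemma l2_norm_finite_sum_le:
  assumes "f \<in> l2 X" and "finite A" and "A \<subseteq> X"
  shows "(\<Sum>x\<in>A. (cmod (f x))\<^sup>2) \<le> (l2_norm X f)\<^sup>2"
  unfolding l2_norm_sq by (rule finite_sum_le_infsum[OF l2_summable[OF assms(1)]]) (use assms in auto)

lemma cmod_le_l2_norm:
  assumes "f \<in> l2 X" shows "cmod (f x) \<le> l2_norm X f"
proof (cases "x \<in> X")
  case True
  then have "(cmod (f x))\<^sup>2 \<le> (l2_norm X f)\<^sup>2"
    using l2_norm_finite_sum_le[OF assms, of "{x}"] by simp
  then show ?thesis by (rule power2_le_imp_le) (rule l2_norm_nonneg)
qed (simp add: l2_outside[OF assms] l2_norm_nonneg)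

lemma l2_norm_eq_0D: "f \<in> l2 X \<Longrightarrow> l2_norm X f = 0 \<Longrightarrow> f = (\<lambda>x. 0)"
  using cmod_le_l2_norm[of f X] by (simp add: fun_eq_iff)

text \<open>Cauchy-Schwarz on finite sets with a bound independent of \<open>A\<close>; it yields
  both absolute convergence of the inner product and the full inequality.\<close>

lemma l2_product_sum_le:
  assumes "f \<in> l2 X" and "g \<in> l2 X" and "finite A" and "A \<subseteq> X"
  shows "(\<Sum>x\<in>A. cmod (f x * cnj (g x))) \<le> l2_norm X f * l2_norm X g"
proof -
  have L2: "L2_set (\<lambda>x. cmod (h x)) A \<le> l2_norm X h" if "h \<in> l2 X" for h
    unfolding L2_set_def using l2_norm_finite_sum_le[OF that assms(3,4)] l2_norm_nonneg
    by (rule real_le_lsqrt[rotated])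
  have "(\<Sum>x\<in>A. cmod (f x * cnj (g x))) \<le> L2_set (\<lambda>x. cmod (f x)) A * L2_set (\<lambda>x. cmod (g x)) A"
    using L2_set_mult_ineq[of "\<lambda>x. cmod (f x)" "\<lambda>x. cmod (g x)" A] by (simp add: norm_mult)
  also have "\<dots> \<le> l2_norm X f * l2_norm X g"
    by (intro mult_mono L2 assms L2_set_nonneg l2_norm_nonneg)
  finally show ?thesis .
qed

lemma l2_product_abs_summable:
  assumes "f \<in> l2 X" and "g \<in> l2 X"
  shows "(\<lambda>x. cmod (f x * cnj (g x))) summable_on X"
  by (rule nonneg_bdd_above_summable_on)
     (auto intro!: bdd_aboveI2 l2_product_sum_le[OF assms])

lemma l2_product_summable:
  "f \<in> l2 X \<Longrightarrow> g \<in> l2 X \<Longrightarrow> (\<lambda>x. f x * cnj (g x)) summable_on X"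
  by (rule abs_summable_summable) (rule l2_product_abs_summable)

lemma l2_Cauchy_Schwarz:
  assumes "f \<in> l2 X" and "g \<in> l2 X"
  shows "cmod (l2_inner X f g) \<le> l2_norm X f * l2_norm X g"
proof -
  have "cmod (l2_inner X f g) \<le> (\<Sum>\<^sub>\<infinity>x\<in>X. cmod (f x * cnj (g x)))"
    unfolding l2_inner_def by (rule norm_infsum_bound[OF l2_product_abs_summable[OF assms]])
  also have "\<dots> \<le> l2_norm X f * l2_norm X g"
    by (rule infsum_le_finite_sums[OF l2_product_abs_summable[OF assms] l2_product_sum_le[OF assms]])
  finally show ?thesis .
qed

lemma l2_inner_add_left:
  "f \<in> l2 X \<Longrightarrow> g \<in> l2 X \<Longrightarrow> h \<in> l2 X \<Longrightarrow>
    l2_inner X (\<lambda>x. f x + g x) h = l2_inner X f h + l2_inner X g h"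
  unfolding l2_inner_def distrib_right by (intro infsum_add l2_product_summable)

lemma l2_inner_scale_left: "l2_inner X (\<lambda>x. c * f x) g = c * l2_inner X f g"
  unfolding l2_inner_def mult.assoc by (rule infsum_cmult_right')

lemma l2_inner_commute: "l2_inner X g f = cnj (l2_inner X f g)"
  unfolding l2_inner_def infsum_cnj[symmetric] by (simp add: mult.commute)

lemma l2_inner_diff_left:
  assumes "f \<in> l2 X" and "g \<in> l2 X" and "h \<in> l2 X"
  shows "l2_inner X (\<lambda>x. f x - g x) h = l2_inner X f h - l2_inner X g h"
  using l2_inner_add_left[OF assms(1) l2_scale[OF assms(2), of "-1"] assms(3)]
    l2_inner_scale_left[of X "-1" g h] by simp

lemma l2_inner_add_right:
  "f \<in> l2 X \<Longrightarrow> g \<in> l2 X \<Longrightarrow> h \<in> l2 X \<Longrightarrow>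
    l2_inner X h (\<lambda>x. f x + g x) = l2_inner X h f + l2_inner X h g"
  by (simp add: l2_inner_add_left l2_inner_commute[of X h "\<lambda>x. f x + g x"]
      l2_inner_commute[of X h f] l2_inner_commute[of X h g])

lemma l2_inner_scale_right: "l2_inner X g (\<lambda>x. c * f x) = cnj c * l2_inner X g f"
  by (simp add: l2_inner_scale_left l2_inner_commute[of X g "\<lambda>x. c * f x"] l2_inner_commute[of X g f])

lemma l2_inner_diff_right:
  "f \<in> l2 X \<Longrightarrow> g \<in> l2 X \<Longrightarrow> h \<in> l2 X \<Longrightarrow>
    l2_inner X h (\<lambda>x. f x - g x) = l2_inner X h f - l2_inner X h g"
  by (simp add: l2_inner_diff_left l2_inner_commute[of X h "\<lambda>x. f x - g x"]
      l2_inner_commute[of X h f] l2_inner_commute[of X h g])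

lemma l2_inner_sum_left:
  "(\<And>i. i \<in> I \<Longrightarrow> f i \<in> l2 X) \<Longrightarrow> g \<in> l2 X \<Longrightarrow>
    l2_inner X (\<lambda>x. \<Sum>i\<in>I. f i x) g = (\<Sum>i\<in>I. l2_inner X (f i) g)"
proof (induction I rule: infinite_finite_induct)
  case (insert i I)
  then show ?case by (simp add: l2_inner_add_left l2_sum)
qed (simp_all add: l2_inner_def)

lemma l2_inner_self:
  assumes "f \<in> l2 X" shows "l2_inner X f f = complex_of_real ((l2_norm X f)\<^sup>2)"
proof -
  have "f x * cnj (f x) = complex_of_real ((cmod (f x))\<^sup>2)" for x
    by (simp add: complex_mult_cnj cmod_power2)
  then show ?thesis
    unfolding l2_inner_def l2_norm_sq
    using has_sum_of_real[OF has_sum_infsum[OF l2_summable[OF assms]]]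
    by (simp only:) (rule infsumI)
qed

lemma l2_inner_delta_right:
  assumes "f \<in> l2 X" shows "y \<in> X \<Longrightarrow> l2_inner X f (l2_delta y) = f y"
  unfolding l2_inner_def l2_delta_def
  by (subst infsum_cong_neutral[where T = "{y}" and g = f]) auto

section \<open>Pointwise limits and completeness\<close>

text \<open>A form of Fatou's lemma: every finite partial sum of squares passes to the pointwise
  limit and keeps the bound.\<close>

lemma l2_limit:
  fixes F :: "nat \<Rightarrow> 'a \<Rightarrow> complex"
  assumes F: "\<And>n. F n \<in> l2 X" and bound: "\<And>n. n \<ge> N \<Longrightarrow> l2_norm X (F n) \<le> B" and "0 \<le> B"
    and lim: "\<And>x. (\<lambda>n. F n x) \<longlonglongrightarrow> g x"
  shows "g \<in> l2 X" and "l2_norm X g \<le> B"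
proof -
  have sum_le: "(\<Sum>x\<in>A. (cmod (g x))\<^sup>2) \<le> B\<^sup>2" if A: "finite A" "A \<subseteq> X" for A
  proof (rule LIMSEQ_le_const2)
    show "(\<lambda>n. \<Sum>x\<in>A. (cmod (F n x))\<^sup>2) \<longlonglongrightarrow> (\<Sum>x\<in>A. (cmod (g x))\<^sup>2)"
      by (intro tendsto_intros lim)
    have "(\<Sum>x\<in>A. (cmod (F n x))\<^sup>2) \<le> B\<^sup>2" if "n \<ge> N" for n
      using l2_norm_finite_sum_le[OF F A, of n] power_mono[OF bound[OF that] l2_norm_nonneg, of 2]
      by linarith
    then show "\<exists>N. \<forall>n\<ge>N. (\<Sum>x\<in>A. (cmod (F n x))\<^sup>2) \<le> B\<^sup>2" by blast
  qed
  have "g x = 0" if "x \<notin> X" for x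
    using lim[of x] l2_outside[OF F that] by (simp add: LIMSEQ_const_iff)
  moreover have summable: "(\<lambda>x. (cmod (g x))\<^sup>2) summable_on X"
    by (rule nonneg_bdd_above_summable_on) (auto intro!: bdd_aboveI2 sum_le)
  ultimately show "g \<in> l2 X" by (simp add: l2_def)
  have "(l2_norm X g)\<^sup>2 \<le> B\<^sup>2"
    unfolding l2_norm_sq by (rule infsum_le_finite_sums[OF summable sum_le])
  then show "l2_norm X g \<le> B" by (rule power2_le_imp_le) fact
qed

text \<open>Norms dominate values, so pointwise limits exist. With \<open>n\<close> fixed and
  \<open>m\<close> tending to infinity in \<open>F n - F m\<close>, \<open>l2_limit\<close> turns
  the Cauchy bound into a bound on the distance to the limit.\<close>

lemma l2_complete:
  fixes F :: "nat \<Rightarrow> 'a \<Rightarrow> complex"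
  assumes F: "\<And>n. F n \<in> l2 X"
    and Cauchy: "\<And>e. 0 < e \<Longrightarrow> \<exists>N. \<forall>m\<ge>N. \<forall>n\<ge>N. l2_norm X (\<lambda>x. F m x - F n x) \<le> e"
  obtains g where "g \<in> l2 X" and "\<And>x. (\<lambda>n. F n x) \<longlonglongrightarrow> g x"
    and "(\<lambda>n. l2_norm X (\<lambda>x. F n x - g x)) \<longlonglongrightarrow> 0"
proof -
  have "Cauchy (\<lambda>n. F n x)" for x
  proof (rule CauchyI)
    fix e :: real assume "0 < e"
    with Cauchy[of "e / 2"] obtain N
      where N: "\<And>m n. m \<ge> N \<Longrightarrow> n \<ge> N \<Longrightarrow> l2_norm X (\<lambda>x. F m x - F n x) \<le> e / 2" by auto
    have "cmod (F m x - F n x) < e" if "m \<ge> N" "n \<ge> N" for m n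
      using cmod_le_l2_norm[OF l2_diff[OF F[of m] F[of n]], of x] N[OF that] \<open>0 < e\<close> by linarith
    then show "\<exists>M. \<forall>m\<ge>M. \<forall>n\<ge>M. norm (F m x - F n x) < e" by (intro exI[of _ N]) simp
  qed
  then have g: "(\<lambda>n. F n x) \<longlonglongrightarrow> lim (\<lambda>n. F n x)" for x
    using Cauchy_convergent convergent_LIMSEQ_iff by blast
  define g where "g x = lim (\<lambda>n. F n x)" for x
  note g = g[folded g_def]
  have tail: "\<exists>N. \<forall>n\<ge>N. (\<lambda>x. F n x - g x) \<in> l2 X \<and> l2_norm X (\<lambda>x. F n x - g x) \<le> e"
    if e: "0 < e" for e
  proof -
    obtain N where N: "\<And>m n. m \<ge> N \<Longrightarrow> n \<ge> N \<Longrightarrow> l2_norm X (\<lambda>x. F m x - F n x) \<le> e"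
      using Cauchy[OF e] by auto
    show ?thesis
    proof (intro exI[of _ N] allI impI conjI)
      fix n assume n: "n \<ge> N"
      note limit = l2_limit[of "\<lambda>m x. F n x - F m x" X N e "\<lambda>x. F n x - g x",
          OF l2_diff[OF F F] N[OF n] less_imp_le[OF e] tendsto_diff[OF tendsto_const g]]
      show "(\<lambda>x. F n x - g x) \<in> l2 X" by (rule limit(1))
      show "l2_norm X (\<lambda>x. F n x - g x) \<le> e" by (rule limit(2))
    qed
  qed
  from tail[of 1] obtain n where "(\<lambda>x. F n x - g x) \<in> l2 X" by auto
  from l2_diff[OF F[of n] this] have "g \<in> l2 X" by simp
  moreover have "(\<lambda>n. l2_norm X (\<lambda>x. F n x - g x)) \<longlonglongrightarrow> 0"
  proof (rule LIMSEQ_I)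
    fix r :: real assume "0 < r"
    with tail[of "r / 2"] obtain N where "\<And>n. n \<ge> N \<Longrightarrow> l2_norm X (\<lambda>x. F n x - g x) \<le> r / 2"
      by auto
    moreover have "r / 2 < r" using \<open>0 < r\<close> by simp
    ultimately have "l2_norm X (\<lambda>x. F n x - g x) < r" if "n \<ge> N" for n
      using that by (meson le_less_trans)
    then show "\<exists>N. \<forall>n\<ge>N. norm (l2_norm X (\<lambda>x. F n x - g x) - 0) < r"
      by (intro exI[of _ N]) (simp add: l2_norm_nonneg)
  qed
  ultimately show ?thesis by (rule that[OF _ g])
qed

subsection \<open>Spectral measures of positive operators\<close>

lemma pcompose_power: "pcompose (p ^ n) r = pcompose p r ^ n"
  by (induction n) (simp_all add: pcompose_1 pcompose_mult)

text \<open>Complex polarization: the form of the difference \<open>D\<close> vanishes on the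
  diagonal; testing with \<open>f + g\<close> and with \<open>f + \<i> * g\<close> makes it vanish
  everywhere. Pairing with delta functions then gives \<open>D f = 0\<close>.\<close>

lemma l2_operator_eqI:
  assumes T: "l2_bounded_operator X T" and T': "l2_bounded_operator X T'"
    and eq: "\<And>f. f \<in> l2 X \<Longrightarrow> l2_inner X (T f) f = l2_inner X (T' f) f"
  shows "T = T'"
proof
  fix f
  have TE: "T \<in> l2 X \<rightarrow>\<^sub>E l2 X" "T' \<in> l2 X \<rightarrow>\<^sub>E l2 X"
    using T T' by (auto simp: l2_bounded_operator_def)
  define D where "D f x = T f x - T' f x" for f x
  have D_l2: "D f \<in> l2 X" if "f \<in> l2 X" for f
    unfolding D_def using TE that by (intro l2_diff) auto
  have D_add: "D (\<lambda>x. f x + g x) = (\<lambda>x. D f x + D g x)" if "f \<in> l2 X" "g \<in> l2 X" for f g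
    using T T' that by (simp add: D_def l2_bounded_operator_def fun_eq_iff)
  have D_scale: "D (\<lambda>x. c * f x) = (\<lambda>x. c * D f x)" if "f \<in> l2 X" for c f
    using T T' that by (simp add: D_def l2_bounded_operator_def fun_eq_iff right_diff_distrib)
  have D_quad: "l2_inner X (D f) f = 0" if "f \<in> l2 X" for f
    using eq[OF that] TE that PiE_mem[OF TE(1) that] PiE_mem[OF TE(2) that]
    unfolding D_def by (simp add: l2_inner_diff_left)
  have D_polar: "l2_inner X (D f) g + l2_inner X (D g) f = 0" if "f \<in> l2 X" "g \<in> l2 X" for f g
    using D_quad[OF l2_add[OF that]] that
    by (simp add: D_add l2_inner_add_left l2_inner_add_right D_l2 l2_add D_quad)
  have D_zero: "l2_inner X (D f) g = 0" if f: "f \<in> l2 X" and g: "g \<in> l2 X" for f g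
  proof -
    have "- \<i> * l2_inner X (D f) g + \<i> * l2_inner X (D g) f = 0"
      using D_polar[OF f l2_scale[OF g, of \<i>]]
      by (simp add: D_scale g l2_inner_scale_left l2_inner_scale_right)
    then have "\<i> * l2_inner X (D g) f = \<i> * l2_inner X (D f) g" by simp
    then have "l2_inner X (D g) f = l2_inner X (D f) g" by (subst (asm) mult_cancel_left) simp
    with D_polar[OF f g] show ?thesis by simp
  qed
  show "T f = T' f"
  proof (cases "f \<in> l2 X")
    case True
    have "D f x = 0" for x
    proof (cases "x \<in> X")
      case x: True
      show ?thesis
        using D_zero[OF True l2_delta_in_l2[OF x]] l2_inner_delta_right[OF D_l2[OF True] x] by simp
    qed (rule l2_outside[OF D_l2[OF True]])
    then show ?thesis by (simp add: D_def fun_eq_iff)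
  next
    case False
    \<comment> \<open>Off \<open>l2 X\<close> both operators are \<open>undefined\<close>, being
      extensional.\<close>
    with TE show ?thesis by (metis PiE_arb)
  qed
qed

text \<open>Self-adjoint operators with \<open>0 \<le> A \<le> c\<close> in the sense of quadratic
  forms. Linearity is asked on all functions, so that identities between polynomials in
  \<open>A\<close> hold without membership conditions.\<close>

locale l2_positive_operator =
  fixes X :: "'a set" and A :: "('a \<Rightarrow> complex) \<Rightarrow> 'a \<Rightarrow> complex" and c :: real
  assumes c_pos: "0 < c"
    and A_add: "\<And>f g. A (\<lambda>x. f x + g x) = (\<lambda>x. A f x + A g x)"
    and A_scale: "\<And>b f. A (\<lambda>x. b * f x) = (\<lambda>x. b * A f x)"
    and A_l2: "\<And>f. f \<in> l2 X \<Longrightarrow> A f \<in> l2 X"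
    and A_sym: "\<And>f g. f \<in> l2 X \<Longrightarrow> g \<in> l2 X \<Longrightarrow> l2_inner X (A f) g = l2_inner X f (A g)"
    and A_nonneg: "\<And>f. f \<in> l2 X \<Longrightarrow> 0 \<le> Re (l2_inner X (A f) f)"
    and A_le: "\<And>f. f \<in> l2 X \<Longrightarrow> Re (l2_inner X (A f) f) \<le> c * (l2_norm X f)\<^sup>2"
begin

section \<open>Polynomials in the operator\<close>

definition op_poly :: "real poly \<Rightarrow> ('a \<Rightarrow> complex) \<Rightarrow> 'a \<Rightarrow> complex" where
  "op_poly p f = (\<lambda>x. \<Sum>i\<le>degree p. complex_of_real (coeff p i) * (A ^^ i) f x)"

lemma A_zero: "A (\<lambda>x. 0) = (\<lambda>x. 0)"
  using A_scale[of 0 "\<lambda>x. 0"] by simp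

lemma A_sum: "A (\<lambda>x. \<Sum>i\<in>I. b i * h i x) = (\<lambda>x. \<Sum>i\<in>I. b i * A (h i) x)"
  by (induction I rule: infinite_finite_induct) (simp_all add: A_zero A_add A_scale)

lemma op_poly_altdef:
  assumes "degree p \<le> n"
  shows "op_poly p f = (\<lambda>x. \<Sum>i\<le>n. complex_of_real (coeff p i) * (A ^^ i) f x)"
  unfolding op_poly_def
  by (rule ext, rule sum.mono_neutral_left) (use assms in \<open>auto simp: coeff_eq_0\<close>)

lemma op_poly_0: "op_poly 0 f = (\<lambda>x. 0)" by (simp add: op_poly_def)

lemma op_poly_1: "op_poly 1 f = f" by (simp add: op_poly_def)

lemma op_poly_pCons: "op_poly (pCons a p) f = (\<lambda>x. complex_of_real a * f x + A (op_poly p f) x)"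
proof
  fix x
  have "op_poly (pCons a p) f x
      = (\<Sum>i\<le>Suc (degree p). complex_of_real (coeff (pCons a p) i) * (A ^^ i) f x)"
    by (subst op_poly_altdef[of _ "Suc (degree p)"]) (simp_all add: degree_pCons_le)
  also have "\<dots> = complex_of_real a * f x
      + (\<Sum>i\<le>degree p. complex_of_real (coeff p i) * A ((A ^^ i) f) x)"
    by (subst sum.atMost_Suc_shift) simp
  also have "\<dots> = complex_of_real a * f x + A (op_poly p f) x"
    by (simp add: op_poly_def A_sum)
  finally show "op_poly (pCons a p) f x = complex_of_real a * f x + A (op_poly p f) x" .
qed

lemma op_poly_degree_1:
  "op_poly [:a, b:] f = (\<lambda>x. complex_of_real a * f x + complex_of_real b * A f x)"
  by (simp add: op_poly_pCons op_poly_0 A_zero A_scale)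

lemma op_poly_add: "op_poly (p + q) f = (\<lambda>x. op_poly p f x + op_poly q f x)"
  by (simp add: op_poly_altdef[of _ "max (degree p) (degree q)"] degree_add_le
      sum.distrib distrib_right)

lemma op_poly_smult: "op_poly (smult b p) f = (\<lambda>x. complex_of_real b * op_poly p f x)"
  by (simp add: op_poly_altdef[of _ "degree p"] degree_smult_le sum_distrib_left mult.assoc)

lemma op_poly_diff: "op_poly (p - q) f = (\<lambda>x. op_poly p f x - op_poly q f x)"
  using op_poly_add[of p "smult (-1) q" f] unfolding op_poly_smult by simp

lemma op_poly_mult: "op_poly (p * q) f = op_poly p (op_poly q f)"
proof (induction p)
  case (pCons a p)
  then show ?case
    by (simp add: op_poly_add op_poly_smult op_poly_pCons)
qed (simp add: op_poly_0)

lemma op_poly_monom: "op_poly (monom 1 n) f = (A ^^ n) f"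
  by (induction n) (simp_all add: monom_Suc op_poly_pCons op_poly_1 monom_0 flip: one_pCons)

lemma op_poly_linear:
  "op_poly p (\<lambda>x. f x + g x) = (\<lambda>x. op_poly p f x + op_poly p g x)"
  "op_poly p (\<lambda>x. b * f x) = (\<lambda>x. b * op_poly p f x)"
  by (induction p)
     (simp_all add: op_poly_0 op_poly_pCons A_add A_scale algebra_simps)

lemma op_poly_l2: "f \<in> l2 X \<Longrightarrow> op_poly p f \<in> l2 X"
  by (induction p) (auto simp: op_poly_0 op_poly_pCons l2_zero intro!: l2_add l2_scale A_l2)

lemma op_poly_sym:
  assumes f: "f \<in> l2 X" and g: "g \<in> l2 X"
  shows "l2_inner X (op_poly p f) g = l2_inner X f (op_poly p g)"
  using g
proof (induction p arbitrary: g)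
  case 0
  show ?case by (simp add: op_poly_0 l2_inner_def)
next
  case (pCons a p)
  \<comment> \<open>\<open>A\<close> commutes with \<open>p(A)\<close> because multiplication of
    polynomials is commutative.\<close>
  have "op_poly p (A g) = A (op_poly p g)"
    using op_poly_mult[of p "[:0, 1:]" g] op_poly_mult[of "[:0, 1:]" p g]
    by (simp add: op_poly_pCons op_poly_0 op_poly_1 A_zero mult.commute[of p])
  then show ?case
    by (simp add: op_poly_pCons l2_inner_add_left l2_inner_add_right l2_inner_scale_left
        l2_inner_scale_right l2_scale A_l2 op_poly_l2 f pCons.prems A_sym pCons.IH)
qed

lemma op_poly_norm_sq:
  assumes "f \<in> l2 X"
  shows "(l2_norm X (op_poly p f))\<^sup>2 = Re (l2_inner X (op_poly (p * p) f) f)"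
  using l2_inner_self[OF op_poly_l2[OF assms], of p]
  by (simp add: op_poly_mult op_poly_sym[OF op_poly_l2[OF assms] assms])

lemma op_poly_inner_real:
  assumes "f \<in> l2 X"
  shows "l2_inner X (op_poly p f) f = complex_of_real (Re (l2_inner X (op_poly p f) f))"
proof -
  have "l2_inner X (op_poly p f) f = cnj (l2_inner X (op_poly p f) f)"
    using op_poly_sym[OF assms assms, of p] l2_inner_commute[of X f] by metis
  then have "Im (l2_inner X (op_poly p f) f) = - Im (l2_inner X (op_poly p f) f)"
    by (metis cnj.simps(2))
  then show ?thesis by (simp add: complex_eq_iff)
qed

section \<open>Positivity of polynomials in the operator\<close>

text \<open>Positivity refers to the operator \<open>p(A)\<close>, not to the values of
  \<open>p\<close>; the spectral measure that links the two is constructed from it.\<close>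

definition positive_poly :: "real poly \<Rightarrow> bool" where
  "positive_poly p \<longleftrightarrow> (\<forall>f\<in>l2 X. 0 \<le> Re (l2_inner X (op_poly p f) f))"

text \<open>By symmetry one factor \<open>q(A)\<close> moves to the other side of the inner product,
  leaving the form of \<open>r(A)\<close> at the vector \<open>q(A) f\<close>.\<close>

lemma positive_poly_square_mult:
  assumes "positive_poly r" shows "positive_poly (q\<^sup>2 * r)"
  unfolding positive_poly_def
proof
  fix f assume f: "f \<in> l2 X"
  have "op_poly (q\<^sup>2 * r) f = op_poly q (op_poly r (op_poly q f))"
    by (simp add: op_poly_mult[symmetric] power2_eq_square mult_ac)
  then have "l2_inner X (op_poly (q\<^sup>2 * r) f) f = l2_inner X (op_poly r (op_poly q f)) (op_poly q f)"
    by (simp add: op_poly_sym op_poly_l2 f)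
  with assms show "0 \<le> Re (l2_inner X (op_poly (q\<^sup>2 * r) f) f)"
    by (simp add: positive_poly_def op_poly_l2 f)
qed

lemma positive_poly_add: "positive_poly p \<Longrightarrow> positive_poly q \<Longrightarrow> positive_poly (p + q)"
  by (simp add: positive_poly_def op_poly_add l2_inner_add_left op_poly_l2)

text \<open>Write \<open>P = A/c\<close> and \<open>Q = 1 - A/c\<close>, both positive by the bounds
  on \<open>A\<close>. Since \<open>P + Q = 1\<close>, the product \<open>P Q\<close> equals
  \<open>P\<^sup>2 Q + Q\<^sup>2 P\<close> and is positive too. Pulling squares out of the powers
  leaves exponents 0 or 1, where one of these cases applies.\<close>

lemma positive_poly_monomials: "positive_poly ([:0, 1/c:] ^ k * [:1, -1/c:] ^ l)"
proof -
  let ?P = "[:0, 1/c:]" and ?Q = "[:1, -1/c:]"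
  have one: "positive_poly 1"
    by (simp add: positive_poly_def op_poly_1 l2_inner_self)
  have lin: "Re (l2_inner X (op_poly [:a, b:] f) f) = a * (l2_norm X f)\<^sup>2 + b * Re (l2_inner X (A f) f)"
    if "f \<in> l2 X" for a b f
    unfolding op_poly_degree_1 using that
    by (simp add: l2_inner_add_left l2_scale A_l2 l2_inner_scale_left l2_inner_self)
  have P: "positive_poly ?P"
    unfolding positive_poly_def using c_pos A_nonneg by (simp add: lin)
  have Q: "positive_poly ?Q"
    unfolding positive_poly_def using c_pos A_le by (simp add: lin field_simps)
  have PQ1: "?P + ?Q = 1" by (simp add: one_pCons)
  have "?P\<^sup>2 * ?Q + ?Q\<^sup>2 * ?P = ?P * ?Q * (?P + ?Q)"
    by (simp only: power2_eq_square distrib_left mult_ac add.commute)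
  then have PQ: "positive_poly (?P * ?Q)"
    using positive_poly_add[OF positive_poly_square_mult[OF Q, of ?P] positive_poly_square_mult[OF P, of ?Q]]
    unfolding PQ1 by simp
  have "?P ^ k * ?Q ^ l = (?P ^ (k div 2) * ?Q ^ (l div 2))\<^sup>2 * (?P ^ (k mod 2) * ?Q ^ (l mod 2))"
  proof -
    have split: "r ^ n = (r ^ (n div 2))\<^sup>2 * r ^ (n mod 2)" for r :: "real poly" and n
      by (simp only: power_mult[symmetric] power_add[symmetric]) simp
    show ?thesis
      by (subst split[of ?P k], subst split[of ?Q l]) (simp only: power_mult_distrib mult_ac)
  qed
  moreover have "positive_poly (?P ^ (k mod 2) * ?Q ^ (l mod 2))"
  proof -
    have cases: "n mod 2 = 0 \<or> n mod 2 = 1" for n :: nat by auto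
    show ?thesis
      using cases[of k] cases[of l]
      by (elim disjE) (simp_all only: power_0 power_one_right mult_1_left mult_1_right one P Q PQ)
  qed
  ultimately show ?thesis by (simp only: positive_poly_square_mult)
qed

section \<open>Existence and uniqueness of the spectral measure\<close>

text \<open>Sharpens the condition inside \<open>l2_spectral_measure\<close>: the support bound is
  the explicit \<open>c\<close> instead of some \<open>r\<close>.\<close>

definition spectral_measure_of :: "('a \<Rightarrow> complex) \<Rightarrow> real measure \<Rightarrow> bool" where
  "spectral_measure_of f \<mu> \<longleftrightarrow> sets \<mu> = sets borel \<and> finite_measure \<mu> \<and> (AE x in \<mu>. \<bar>x\<bar> \<le> c) \<and>
     (\<forall>n. l2_inner X ((A ^^ n) f) f = complex_of_real (\<integral>x. x ^ n \<partial>\<mu>))"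

text \<open>Positivity of \<open>(A/c)\<^sup>k (1 - A/c)\<^sup>l\<close> is exactly the hypothesis
  of the Hausdorff moment problem for the rescaled quadratic form. A vector of norm 0 is treated
  apart because the form is divided by the squared norm.\<close>

lemma spectral_measure_of_exists:
  assumes f: "f \<in> l2 X"
  shows "\<exists>\<mu>. spectral_measure_of f \<mu>"
proof (cases "l2_norm X f = 0")
  case True
  then have "f = (\<lambda>x. 0)" by (rule l2_norm_eq_0D[OF f])
  moreover have "(A ^^ n) (\<lambda>x. 0) = (\<lambda>x. 0)" for n by (induction n) (simp_all add: A_zero)
  ultimately have "l2_inner X ((A ^^ n) f) f = 0" for n by (simp add: l2_inner_def)
  moreover have "finite_measure (null_measure (borel :: real measure))"
    by (rule finite_measureI) simp
  moreover have "AE x in null_measure borel. \<bar>x\<bar> \<le> c" by (rule AE_I[of _ _ UNIV]) simp_all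
  ultimately have "spectral_measure_of f (null_measure borel)"
    by (simp add: spectral_measure_of_def)
  then show ?thesis ..
next
  case False
  define s where "s = (l2_norm X f)\<^sup>2"
  have s: "0 < s" using False by (simp add: s_def)
  define L where "L p = Re (l2_inner X (op_poly (pcompose p [:0, 1/c:]) f) f) / s" for p
  have "L (p + q) = L p + L q" for p q
    by (simp add: L_def pcompose_add op_poly_add l2_inner_add_left op_poly_l2 f add_divide_distrib)
  moreover have "L (smult b p) = b * L p" for b p
    by (simp add: L_def pcompose_smult op_poly_smult l2_inner_scale_left)
  moreover have "0 \<le> L ([:0, 1:] ^ k * [:1, -1:] ^ l)" for k l
  proof -
    have "pcompose ([:0, 1:] ^ k * [:1, -1:] ^ l) [:0, 1/c:] = [:0, 1/c:] ^ k * [:1, -1/c:] ^ l"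
      by (simp add: pcompose_mult pcompose_power pcompose_pCons)
    then show ?thesis
      using positive_poly_monomials[of k l] s f by (simp add: L_def positive_poly_def)
  qed
  moreover have "L 1 = 1"
    using s by (simp add: L_def pcompose_1 op_poly_1 l2_inner_self[OF f] s_def)
  ultimately obtain M where M: "real_distribution M" "AE x in M. x \<in> {0..1}"
    "\<And>n. (\<integral>x. x ^ n \<partial>M) = L (monom 1 n)"
    by (rule hausdorff_moment_problem[of L]) blast
  interpret M: real_distribution M by (rule M(1))
  \<comment> \<open>The density \<open>s\<close> and the dilation by \<open>c\<close> undo the
    normalization in \<open>L\<close>.\<close>
  define \<mu> where "\<mu> = distr (density M (\<lambda>_. ennreal s)) borel (\<lambda>x. c * x)"
  have meas: "(\<lambda>x. c * x) \<in> measurable (density M (\<lambda>_. ennreal s)) borel"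
    by (simp add: measurable_density_eq1)
  have moments: "(\<integral>x. x ^ n \<partial>\<mu>) = Re (l2_inner X ((A ^^ n) f) f)" for n
  proof -
    have pc: "pcompose (monom 1 n) [:0, 1/c:] = smult ((1/c) ^ n) (monom 1 n)"
      using smult_power[of "1/c" "[:0, 1:]" n]
      by (simp add: monom_altdef pcompose_power pcompose_pCons)
    have "(\<integral>x. x ^ n \<partial>\<mu>) = (\<integral>x. (c * x) ^ n \<partial>density M (\<lambda>_. ennreal s))"
      unfolding \<mu>_def by (rule integral_distr[OF meas]) simp
    also have "\<dots> = (\<integral>x. s *\<^sub>R (c * x) ^ n \<partial>M)"
      by (rule integral_density) (use s in auto)
    also have "\<dots> = s * c ^ n * L (monom 1 n)"
      by (simp add: power_mult_distrib M(3))
    also have "\<dots> = Re (l2_inner X ((A ^^ n) f) f)"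
    proof -
      have "Re (complex_of_real r * z) = r * Re z" for r z by simp
      then show ?thesis
        unfolding L_def pc op_poly_smult op_poly_monom l2_inner_scale_left
        using c_pos s by (simp add: power_one_over)
    qed
    finally show ?thesis .
  qed
  have "finite_measure \<mu>"
  proof (rule finite_measureI)
    have "emeasure \<mu> (space \<mu>) = ennreal s * emeasure M (space M)"
      unfolding \<mu>_def by (subst emeasure_distr[OF meas]) (auto simp: emeasure_density_const)
    then show "emeasure \<mu> (space \<mu>) \<noteq> \<infinity>"
      by (simp add: M.emeasure_space_1[unfolded M.space_eq_univ])
  qed
  moreover have "AE x in \<mu>. \<bar>x\<bar> \<le> c"
  proof -
    have "AE x in M. \<bar>c * x\<bar> \<le> c"
      using M(2) by eventually_elim (use c_pos in \<open>auto simp: abs_mult\<close>)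
    then show ?thesis
      unfolding \<mu>_def by (subst AE_distr_iff[OF meas]) (auto simp: AE_density elim!: eventually_mono)
  qed
  moreover have "l2_inner X ((A ^^ n) f) f = complex_of_real (\<integral>x. x ^ n \<partial>\<mu>)" for n
    using op_poly_inner_real[OF f, of "monom 1 n"] by (simp add: op_poly_monom moments)
  moreover have "sets \<mu> = sets borel" by (simp add: \<mu>_def)
  ultimately have "spectral_measure_of f \<mu>"
    by (simp add: spectral_measure_of_def)
  then show ?thesis ..
qed

text \<open>Existence together with \<open>moments_determine_measure\<close> makes the definite
  description denote. Competitors may have any support bound \<open>r\<close>, so uniqueness is
  needed across different bounds.\<close>

lemma l2_spectral_measure_correct:
  assumes f: "f \<in> l2 X"
  shows "spectral_measure_of f (l2_spectral_measure X A f)"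
proof -
  obtain \<mu> where \<mu>: "spectral_measure_of f \<mu>" using spectral_measure_of_exists[OF f] ..
  have "l2_spectral_measure X A f = \<mu>"
    unfolding l2_spectral_measure_def
  proof (rule the_equality)
    show "sets \<mu> = sets borel \<and> finite_measure \<mu> \<and> (\<exists>r. AE x in \<mu>. \<bar>x\<bar> \<le> r) \<and>
        (\<forall>n. l2_inner X ((A ^^ n) f) f = complex_of_real (\<integral>x. x ^ n \<partial>\<mu>))"
      using \<mu> by (auto simp: spectral_measure_of_def)
  next
    fix \<nu>
    assume \<nu>: "sets \<nu> = sets borel \<and> finite_measure \<nu> \<and> (\<exists>r. AE x in \<nu>. \<bar>x\<bar> \<le> r) \<and>
        (\<forall>n. l2_inner X ((A ^^ n) f) f = complex_of_real (\<integral>x. x ^ n \<partial>\<nu>))"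
    then obtain r where r: "AE x in \<nu>. \<bar>x\<bar> \<le> r" by blast
    show "\<nu> = \<mu>"
      by (rule moments_determine_measure[OF _ _ r])
         (use \<mu> \<nu> in \<open>auto simp: spectral_measure_of_def\<close>)
  qed
  with \<mu> show ?thesis by simp
qed

lemma
  assumes f: "f \<in> l2 X"
  shows sets_spectral: "sets (l2_spectral_measure X A f) = sets borel"
    and finite_spectral: "finite_measure (l2_spectral_measure X A f)"
    and AE_spectral: "AE x in l2_spectral_measure X A f. \<bar>x\<bar> \<le> c"
    and moment_spectral: "l2_inner X ((A ^^ n) f) f
           = complex_of_real (\<integral>x. x ^ n \<partial>l2_spectral_measure X A f)"
  using l2_spectral_measure_correct[OF f] by (simp_all add: spectral_measure_of_def)

lemma integral_poly_spectral:
  assumes f: "f \<in> l2 X"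
  shows "l2_inner X (op_poly p f) f = complex_of_real (\<integral>x. poly p x \<partial>l2_spectral_measure X A f)"
proof -
  have in_l2: "(A ^^ i) f \<in> l2 X" for i
    using op_poly_l2[OF f, of "monom 1 i"] by (simp add: op_poly_monom)
  have "l2_inner X (op_poly p f) f
      = (\<Sum>i\<le>degree p. complex_of_real (coeff p i) * l2_inner X ((A ^^ i) f) f)"
    unfolding op_poly_def
    by (subst l2_inner_sum_left) (auto intro!: l2_scale in_l2 f simp: l2_inner_scale_left)
  then show ?thesis
    by (simp add: moment_spectral[OF f]
        integral_poly[OF finite_spectral[OF f] sets_spectral[OF f] AE_spectral[OF f]])
qed

lemma spectral_total_mass:
  assumes f: "f \<in> l2 X"
  shows "measure (l2_spectral_measure X A f) (space (l2_spectral_measure X A f)) = (l2_norm X f)\<^sup>2"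
  using moment_spectral[OF f, of 0] l2_inner_self[OF f]
  by (simp del: of_real_power)

text \<open>The map from \<open>p\<close> to \<open>p(A) f\<close> is isometric for the square norm
  of the spectral measure; norm estimates become integral estimates.\<close>

lemma l2_norm_op_poly:
  assumes f: "f \<in> l2 X"
  shows "(l2_norm X (op_poly p f))\<^sup>2 = (\<integral>x. (poly p x)\<^sup>2 \<partial>l2_spectral_measure X A f)"
  unfolding op_poly_norm_sq[OF f] integral_poly_spectral[OF f]
  by (simp add: power2_eq_square poly_mult[abs_def])

text \<open>The projection is the strong limit of \<open>p\<^sub>n(A)\<close> for polynomials \<open>p\<^sub>n\<close> tending boundedly to the
  indicator function on the spectrum.\<close>

lemma spectral_projection_exists:
  "\<exists>T. l2_bounded_operator X T \<and>
     (\<forall>f\<in>l2 X. l2_inner X (T f) f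
        = complex_of_real (measure (l2_spectral_measure X A f) {..lam}))"
proof -
  obtain p :: "nat \<Rightarrow> real poly"
    where p: "\<And>x n. \<bar>x\<bar> \<le> c \<Longrightarrow> \<bar>poly (p n) x\<bar> \<le> 2"
      "\<And>x. \<bar>x\<bar> \<le> c \<Longrightarrow> (\<lambda>n. poly (p n) x) \<longlonglongrightarrow> indicator {..lam} x"
  proof -
    have "x \<in> {-c..c}" if "\<bar>x\<bar> \<le> c" for x :: real using that by auto
    then show ?thesis using indicator_polynomial_limit[of c lam] that by blast
  qed
  \<comment> \<open>The value \<open>undefined\<close> off \<open>l2 X\<close> is forced by the
    extensional function space in \<open>l2_bounded_operator\<close>.\<close>
  define T where "T f = (if f \<in> l2 X then (\<lambda>x. lim (\<lambda>n. op_poly (p n) f x)) else undefined)" for f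
  have T: "T f \<in> l2 X" "\<And>x. (\<lambda>n. op_poly (p n) f x) \<longlonglongrightarrow> T f x"
    "(\<lambda>n. l2_norm X (\<lambda>x. op_poly (p n) f x - T f x)) \<longlonglongrightarrow> 0"
    "(\<lambda>n. \<integral>x. poly (p n) x \<partial>l2_spectral_measure X A f)
        \<longlonglongrightarrow> measure (l2_spectral_measure X A f) {..lam}"
    "l2_norm X (T f) \<le> 2 * l2_norm X f"
    if f: "f \<in> l2 X" for f
  proof -
    define \<mu> where "\<mu> = l2_spectral_measure X A f"
    interpret finite_measure \<mu> unfolding \<mu>_def by (rule finite_spectral[OF f])
    have sets: "sets \<mu> = sets borel" unfolding \<mu>_def by (rule sets_spectral[OF f])
    have AE: "AE x in \<mu>. \<bar>x\<bar> \<le> c" unfolding \<mu>_def by (rule AE_spectral[OF f])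
    have space: "space \<mu> = UNIV" using sets_eq_imp_space_eq[OF sets] by simp
    note int = integrable_poly[OF finite_measure_axioms sets AE]
    have meas: "poly q \<in> borel_measurable \<mu>" for q
      using int by (rule borel_measurable_integrable)
    have meas_ind: "(indicator {..lam} :: real \<Rightarrow> real) \<in> borel_measurable \<mu>"
      using sets by (auto simp: space)
    have "(\<lambda>n. \<integral>x. poly (p n) x \<partial>\<mu>) \<longlonglongrightarrow> (\<integral>x. indicator {..lam} x \<partial>\<mu>)"
    proof (rule integral_dominated_convergence[where w = "\<lambda>_. 2"])
      show "AE x in \<mu>. (\<lambda>n. poly (p n) x) \<longlonglongrightarrow> indicator {..lam} x"
        using AE by eventually_elim (rule p(2))
      show "AE x in \<mu>. norm (poly (p n) x) \<le> 2" for n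
        using AE by eventually_elim (use p(1) in simp)
    qed (use meas meas_ind in auto)
    then show "(\<lambda>n. \<integral>x. poly (p n) x \<partial>l2_spectral_measure X A f)
        \<longlonglongrightarrow> measure (l2_spectral_measure X A f) {..lam}"
      by (simp add: space \<mu>_def[symmetric])
    \<comment> \<open>Squared distance from \<open>p n\<close> to the indicator with respect to
      \<open>\<mu>\<close>. The majorant \<open>3\<^sup>2\<close> below comes from the bounds 2 and
      1 on the two functions.\<close>
    define a where "a n = (\<integral>x. (poly (p n) x - indicator {..lam} x)\<^sup>2 \<partial>\<mu>)" for n
    have diff_bound: "AE x in \<mu>. norm ((poly (p n) x - indicator {..lam} x)\<^sup>2) \<le> 3\<^sup>2" for n
      using AE
    proof eventually_elim
      case (elim x)
      have "\<bar>poly (p n) x - indicator {..lam} x\<bar> \<le> 3"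
        using p(1)[OF elim, of n] by (auto simp: indicator_def)
      then have "\<bar>poly (p n) x - indicator {..lam} x\<bar>\<^sup>2 \<le> 3\<^sup>2" by (rule power_mono) simp
      then show ?case by simp
    qed
    have int_a: "integrable \<mu> (\<lambda>x. (poly (p n) x - indicator {..lam} x)\<^sup>2)" for n
      by (rule integrable_const_bound[OF diff_bound]) (use meas meas_ind in auto)
    have "a \<longlonglongrightarrow> (\<integral>x. 0 \<partial>\<mu>)"
      unfolding a_def
    proof (rule integral_dominated_convergence[where w = "\<lambda>_. 3\<^sup>2"])
      show "AE x in \<mu>. (\<lambda>n. (poly (p n) x - indicator {..lam} x)\<^sup>2) \<longlonglongrightarrow> 0"
        using AE
      proof eventually_elim
        case (elim x)
        have "(\<lambda>n. (poly (p n) x - indicator {..lam} x)\<^sup>2)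
            \<longlonglongrightarrow> (indicator {..lam} x - indicator {..lam} x)\<^sup>2"
          by (intro tendsto_intros p(2) elim)
        then show ?case by simp
      qed
    qed (use meas meas_ind diff_bound in auto)
    then have a: "a \<longlonglongrightarrow> 0" by simp
    have norm_diff: "(l2_norm X (\<lambda>x. op_poly (p m) f x - op_poly (p n) f x))\<^sup>2 \<le> 2 * a m + 2 * a n"
      for m n
    proof -
      have "(l2_norm X (\<lambda>x. op_poly (p m) f x - op_poly (p n) f x))\<^sup>2
          = (\<integral>x. (poly (p m - p n) x)\<^sup>2 \<partial>\<mu>)"
        unfolding \<mu>_def l2_norm_op_poly[OF f, symmetric] by (simp add: op_poly_diff)
      also have "\<dots> \<le> (\<integral>x. 2 * (poly (p m) x - indicator {..lam} x)\<^sup>2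
          + 2 * (poly (p n) x - indicator {..lam} x)\<^sup>2 \<partial>\<mu>)"
      proof (rule integral_mono)
        show "integrable \<mu> (\<lambda>x. (poly (p m - p n) x)\<^sup>2)"
          using int[of "(p m - p n)\<^sup>2"] by (simp add: poly_power[abs_def])
        show "(poly (p m - p n) x)\<^sup>2 \<le> 2 * (poly (p m) x - indicator {..lam} x)\<^sup>2
            + 2 * (poly (p n) x - indicator {..lam} x)\<^sup>2" for x
          using zero_le_power2[of "(poly (p m) x - indicator {..lam} x)
              + (poly (p n) x - indicator {..lam} x)"]
          by (simp add: power2_eq_square algebra_simps)
      qed (use int_a in auto)
      also have "\<dots> = 2 * a m + 2 * a n" by (simp add: a_def int_a)
      finally show ?thesis .
    qed
    \<comment> \<open>By \<open>norm_diff\<close>, values of \<open>a\<close> below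
      \<open>e\<^sup>2 / 4\<close> give a norm of at most \<open>e\<close>.\<close>
    have Cauchy: "\<exists>N. \<forall>m\<ge>N. \<forall>n\<ge>N. l2_norm X (\<lambda>x. op_poly (p m) f x - op_poly (p n) f x) \<le> e"
      if e: "0 < e" for e
    proof -
      have "\<forall>\<^sub>F n in sequentially. a n < e\<^sup>2 / 4"
        by (rule order_tendstoD(2)[OF a]) (use e in simp)
      then obtain N where N: "\<And>n. n \<ge> N \<Longrightarrow> a n < e\<^sup>2 / 4"
        unfolding eventually_sequentially by blast
      have "l2_norm X (\<lambda>x. op_poly (p m) f x - op_poly (p n) f x) \<le> e"
        if "m \<ge> N" "n \<ge> N" for m n
        by (rule power2_le_imp_le) (use norm_diff[of m n] N[OF that(1)] N[OF that(2)] e in linarith)+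
      then show ?thesis by blast
    qed
    obtain g where g: "g \<in> l2 X" "\<And>x. (\<lambda>n. op_poly (p n) f x) \<longlonglongrightarrow> g x"
      "(\<lambda>n. l2_norm X (\<lambda>x. op_poly (p n) f x - g x)) \<longlonglongrightarrow> 0"
      using l2_complete[of "\<lambda>n. op_poly (p n) f" X, OF op_poly_l2[OF f] Cauchy] by blast
    have "T f = g" using f limI[OF g(2)] by (simp add: T_def fun_eq_iff)
    with g show "T f \<in> l2 X" and lim: "\<And>x. (\<lambda>n. op_poly (p n) f x) \<longlonglongrightarrow> T f x"
      and "(\<lambda>n. l2_norm X (\<lambda>x. op_poly (p n) f x - T f x)) \<longlonglongrightarrow> 0" by simp_all
    \<comment> \<open>The sup bound 2 on the polynomials becomes an operator norm bound through the
      isometry and survives the limit.\<close>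
    have "l2_norm X (op_poly (p n) f) \<le> 2 * l2_norm X f" for n
    proof (rule power2_le_imp_le)
      have "(l2_norm X (op_poly (p n) f))\<^sup>2 = (\<integral>x. (poly (p n) x)\<^sup>2 \<partial>\<mu>)"
        unfolding \<mu>_def by (rule l2_norm_op_poly[OF f])
      also have "\<dots> \<le> (\<integral>x. 2\<^sup>2 \<partial>\<mu>)"
      proof (rule integral_mono_AE)
        show "integrable \<mu> (\<lambda>x. (poly (p n) x)\<^sup>2)"
          using int[of "(p n)\<^sup>2"] by (simp add: poly_power[abs_def])
        show "AE x in \<mu>. (poly (p n) x)\<^sup>2 \<le> 2\<^sup>2"
          using AE
        proof eventually_elim
          case (elim x)
          have "\<bar>poly (p n) x\<bar>\<^sup>2 \<le> 2\<^sup>2" by (rule power_mono[OF p(1)[OF elim]]) simp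
          then show ?case by simp
        qed
      qed simp
      also have "\<dots> = (2 * l2_norm X f)\<^sup>2"
        using spectral_total_mass[OF f] by (simp add: \<mu>_def power_mult_distrib)
      finally show "(l2_norm X (op_poly (p n) f))\<^sup>2 \<le> (2 * l2_norm X f)\<^sup>2" .
    qed (simp add: l2_norm_nonneg)
    then show "l2_norm X (T f) \<le> 2 * l2_norm X f"
      by (intro l2_limit(2)[OF op_poly_l2[OF f] _ _ lim, of 0]) (auto simp: l2_norm_nonneg)
  qed
  have "l2_bounded_operator X T"
    unfolding l2_bounded_operator_def
  proof (intro conjI ballI allI exI)
    show "T \<in> l2 X \<rightarrow>\<^sub>E l2 X" using T(1) by (auto simp: T_def)
    show "l2_norm X (T f) \<le> 2 * l2_norm X f" if "f \<in> l2 X" for f by (rule T(5)[OF that])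
    show "T (\<lambda>x. f x + g x) = (\<lambda>x. T f x + T g x)" if "f \<in> l2 X" "g \<in> l2 X" for f g
    proof
      fix x
      have "(\<lambda>n. op_poly (p n) f x + op_poly (p n) g x) \<longlonglongrightarrow> T (\<lambda>x. f x + g x) x"
        using T(2)[OF l2_add[OF that], of x] by (simp add: op_poly_linear)
      then show "T (\<lambda>x. f x + g x) x = T f x + T g x"
        using tendsto_add[OF T(2)[OF that(1)] T(2)[OF that(2)]] LIMSEQ_unique by blast
    qed
    show "T (\<lambda>x. b * f x) = (\<lambda>x. b * T f x)" if "f \<in> l2 X" for b f
    proof
      fix x
      have "(\<lambda>n. b * op_poly (p n) f x) \<longlonglongrightarrow> T (\<lambda>x. b * f x) x"
        using T(2)[OF l2_scale[OF that], of b x] by (simp add: op_poly_linear)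
      then show "T (\<lambda>x. b * f x) x = b * T f x"
        using tendsto_mult_left[OF T(2)[OF that]] LIMSEQ_unique by blast
    qed
  qed
  moreover have "l2_inner X (T f) f = complex_of_real (measure (l2_spectral_measure X A f) {..lam})"
    if f: "f \<in> l2 X" for f
  proof -
    \<comment> \<open>Cauchy-Schwarz passes norm convergence to the quadratic form, whose limit is
      already known from the integrals.\<close>
    have "(\<lambda>n. l2_inner X (op_poly (p n) f) f - l2_inner X (T f) f) \<longlonglongrightarrow> 0"
    proof (rule Lim_null_comparison)
      have "cmod (l2_inner X (op_poly (p n) f) f - l2_inner X (T f) f)
          \<le> l2_norm X (\<lambda>x. op_poly (p n) f x - T f x) * l2_norm X f" for n
        using l2_Cauchy_Schwarz[OF l2_diff[OF op_poly_l2[OF f] T(1)[OF f]] f, of "p n"]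
        by (simp add: l2_inner_diff_left op_poly_l2 T(1) f)
      then show "\<forall>\<^sub>F n in sequentially. cmod (l2_inner X (op_poly (p n) f) f - l2_inner X (T f) f)
          \<le> l2_norm X (\<lambda>x. op_poly (p n) f x - T f x) * l2_norm X f" by simp
      show "(\<lambda>n. l2_norm X (\<lambda>x. op_poly (p n) f x - T f x) * l2_norm X f) \<longlonglongrightarrow> 0"
        using tendsto_mult_left_zero[OF T(3)[OF f]] .
    qed
    then have "(\<lambda>n. complex_of_real (\<integral>x. poly (p n) x \<partial>l2_spectral_measure X A f))
        \<longlonglongrightarrow> l2_inner X (T f) f"
      by (simp add: LIM_zero_iff integral_poly_spectral[OF f])
    moreover have "(\<lambda>n. complex_of_real (\<integral>x. poly (p n) x \<partial>l2_spectral_measure X A f))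
        \<longlonglongrightarrow> complex_of_real (measure (l2_spectral_measure X A f) {..lam})"
      by (rule tendsto_of_real[OF T(4)[OF f]])
    ultimately show ?thesis by (rule LIMSEQ_unique)
  qed
  ultimately show ?thesis by blast
qed

text \<open>The strong limit of polynomials satisfies the defining description, and an operator is
  determined by its quadratic form. The calculus uses the complex-valued indicator, hence the
  conversion from the real one.\<close>

lemma functional_calculus_indicator:
  assumes f: "f \<in> l2 X"
  shows "l2_inner X (l2_functional_calculus X A (indicator {..lam}) f) f
           = complex_of_real (measure (l2_spectral_measure X A f) {..lam})"
proof -
  have indicator: "(\<integral>x. indicator {..lam} x \<partial>l2_spectral_measure X A f)
      = complex_of_real (measure (l2_spectral_measure X A f) {..lam})" if f: "f \<in> l2 X" for f
  proof -
    have "(\<integral>x. complex_of_real (indicator {..lam} x) \<partial>l2_spectral_measure X A f)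
        = complex_of_real (measure (l2_spectral_measure X A f) {..lam})"
      using sets_eq_imp_space_eq[OF sets_spectral[OF f]] by simp
    then show ?thesis by (simp add: of_real_indicator)
  qed
  obtain T where T: "l2_bounded_operator X T"
    "\<And>f. f \<in> l2 X \<Longrightarrow> l2_inner X (T f) f
        = complex_of_real (measure (l2_spectral_measure X A f) {..lam})"
    using spectral_projection_exists[of lam] by blast
  have "l2_functional_calculus X A (indicator {..lam}) = T"
    unfolding l2_functional_calculus_def
  proof (rule the_equality)
    show "l2_bounded_operator X T \<and> (\<forall>f\<in>l2 X. l2_inner X (T f) f
        = (\<integral>x. indicator {..lam} x \<partial>l2_spectral_measure X A f))"
      using T by (simp add: indicator)
    show "T' = T" if "l2_bounded_operator X T' \<and> (\<forall>f\<in>l2 X. l2_inner X (T' f) f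
        = (\<integral>x. indicator {..lam} x \<partial>l2_spectral_measure X A f))" for T'
      by (rule l2_operator_eqI[of X]) (use T that in \<open>auto simp: indicator\<close>)
  qed
  then show ?thesis by (simp add: T(2)[OF f])
qed

end

subsection \<open>The Laplace operator and the isoperimetric inequality\<close>

lemma l2_norm_mono:
  assumes g: "g \<in> l2 X" and le: "\<And>x. x \<in> X \<Longrightarrow> cmod (f x) \<le> cmod (g x)"
    and out: "\<And>x. x \<notin> X \<Longrightarrow> f x = 0"
  shows "f \<in> l2 X" and "(l2_norm X f)\<^sup>2 \<le> (l2_norm X g)\<^sup>2"
proof -
  have le2: "(cmod (f x))\<^sup>2 \<le> (cmod (g x))\<^sup>2" if "x \<in> X" for x
    by (rule power_mono[OF le[OF that]]) simp
  have summable: "(\<lambda>x. (cmod (f x))\<^sup>2) summable_on X"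
    by (rule summable_on_comparison_test[OF l2_summable[OF g]]) (use le2 in auto)
  with out show "f \<in> l2 X" by (simp add: l2_def)
  show "(l2_norm X f)\<^sup>2 \<le> (l2_norm X g)\<^sup>2"
    unfolding l2_norm_sq by (rule infsum_mono[OF summable l2_summable[OF g] le2])
qed

section \<open>Translations by generators and the Laplace operator\<close>

locale symmetric_generators = group G for G (structure) +
  fixes S
  assumes finite_S: "finite S" and S_carrier: "S \<subseteq> carrier G" and S_nonempty: "S \<noteq> {}"
    and S_inv: "\<And>s. s \<in> S \<Longrightarrow> inv s \<in> S"
begin

abbreviation lap where "lap \<equiv> laplace_operator G (uniform_weight S)"

text \<open>Right translation, set to 0 off the carrier because elements of \<open>l2\<close> vanish
  there and the product is unspecified.\<close>

definition shift :: "'a \<Rightarrow> ('a \<Rightarrow> complex) \<Rightarrow> 'a \<Rightarrow> complex" where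
  "shift s f = (\<lambda>x. if x \<in> carrier G then f (x \<otimes> s) else 0)"

lemma card_S_pos: "0 < card S" using finite_S S_nonempty by (simp add: card_gt_0_iff)

lemma S_memD: "s \<in> S \<Longrightarrow> s \<in> carrier G" using S_carrier by blast

lemma bij_right_mult: "s \<in> carrier G \<Longrightarrow> bij_betw (\<lambda>x. x \<otimes> s) (carrier G) (carrier G)"
  by (rule bij_betw_byWitness[where f' = "\<lambda>x. x \<otimes> inv s"]) (auto simp: m_assoc)

lemma bij_inv_S: "bij_betw (m_inv G) S S"
  by (rule bij_betw_byWitness[where f' = "m_inv G"]) (use S_inv S_carrier in auto)

text \<open>Inversion permutes \<open>S\<close>, so the inverse in the convolution
  disappears.\<close>

lemma right_convolution_uniform:
  "right_convolution G (uniform_weight S) f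
     = (\<lambda>x. (1 / of_nat (card S)) * (\<Sum>s\<in>S. shift s f x))"
proof
  fix x
  show "right_convolution G (uniform_weight S) f x = (1 / of_nat (card S)) * (\<Sum>s\<in>S. shift s f x)"
  proof (cases "x \<in> carrier G")
    case True
    have weight: "uniform_weight S \<gamma> = (if \<gamma> \<in> S then 1 / real (card S) else 0)" for \<gamma>
      using finite_S by (simp add: uniform_weight_def)
    have "(\<Sum>\<^sub>\<infinity>\<gamma>\<in>carrier G. f (x \<otimes> inv \<gamma>) * complex_of_real (uniform_weight S \<gamma>))
        = (\<Sum>\<^sub>\<infinity>\<gamma>\<in>S. f (x \<otimes> inv \<gamma>) * (1 / of_nat (card S)))"
      by (rule infsum_cong_neutral) (use S_carrier in \<open>auto simp: weight\<close>)
    also have "\<dots> = (\<Sum>s\<in>S. f (x \<otimes> inv s) * (1 / of_nat (card S)))"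
      by (rule infsum_finite[OF finite_S])
    also have "\<dots> = (\<Sum>s\<in>S. f (x \<otimes> s) * (1 / of_nat (card S)))"
      by (rule sum.reindex_bij_betw[OF bij_inv_S, of "\<lambda>s. f (x \<otimes> s) * (1 / of_nat (card S))"])
    finally show ?thesis
      using True by (simp add: right_convolution_def shift_def sum_divide_distrib)
  qed (simp add: right_convolution_def shift_def)
qed

lemma lap_eq: "lap f = (\<lambda>x. f x - (1 / of_nat (card S)) * (\<Sum>s\<in>S. shift s f x))"
  by (simp add: laplace_operator_def right_convolution_uniform)

lemma
  assumes s: "s \<in> carrier G" and f: "f \<in> l2 (carrier G)"
  shows shift_l2: "shift s f \<in> l2 (carrier G)"
    and l2_norm_shift: "l2_norm (carrier G) (shift s f) = l2_norm (carrier G) f"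
proof -
  have eq: "(cmod (shift s f x))\<^sup>2 = (\<lambda>y. (cmod (f y))\<^sup>2) (x \<otimes> s)" if "x \<in> carrier G" for x
    using that by (simp add: shift_def)
  have "(\<lambda>x. (cmod (shift s f x))\<^sup>2) summable_on carrier G"
    using summable_on_reindex_bij_betw[OF bij_right_mult[OF s], of "\<lambda>y. (cmod (f y))\<^sup>2"]
      l2_summable[OF f] by (subst summable_on_cong[OF eq]) auto
  then show "shift s f \<in> l2 (carrier G)" by (simp add: l2_def shift_def)
  show "l2_norm (carrier G) (shift s f) = l2_norm (carrier G) f"
    unfolding l2_norm_def
    using infsum_reindex_bij_betw[OF bij_right_mult[OF s], of "\<lambda>y. (cmod (f y))\<^sup>2"]
    by (subst infsum_cong[OF eq]) auto
qed

lemma shift_adjoint: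
  assumes s: "s \<in> carrier G"
  shows "l2_inner (carrier G) (shift s f) g = l2_inner (carrier G) f (shift (inv s) g)"
proof -
  have "l2_inner (carrier G) (shift s f) g
      = (\<Sum>\<^sub>\<infinity>x\<in>carrier G. (\<lambda>y. f y * cnj (shift (inv s) g y)) (x \<otimes> s))"
    unfolding l2_inner_def using s by (intro infsum_cong) (simp add: shift_def m_assoc)
  then show ?thesis
    unfolding l2_inner_def
    using infsum_reindex_bij_betw[OF bij_right_mult[OF s], of "\<lambda>y. f y * cnj (shift (inv s) g y)"]
    by simp
qed

lemma average_l2:
  "f \<in> l2 (carrier G) \<Longrightarrow> (\<lambda>x. (1 / of_nat (card S)) * (\<Sum>s\<in>S. shift s f x)) \<in> l2 (carrier G)"
  by (intro l2_scale l2_sum shift_l2 S_memD)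

lemma lap_inner:
  assumes f: "f \<in> l2 (carrier G)" and g: "g \<in> l2 (carrier G)"
  shows "l2_inner (carrier G) (lap f) g = l2_inner (carrier G) f g
     - (1 / of_nat (card S)) * (\<Sum>s\<in>S. l2_inner (carrier G) (shift s f) g)"
  unfolding lap_eq
  by (subst l2_inner_diff_left[OF f average_l2[OF f] g], subst l2_inner_scale_left,
      subst l2_inner_sum_left) (auto intro!: shift_l2 f g S_memD)

text \<open>The adjoint of translation by \<open>s\<close> is translation by \<open>inv s\<close>,
  and \<open>S\<close> is closed under inversion.\<close>

lemma lap_symmetric:
  assumes f: "f \<in> l2 (carrier G)" and g: "g \<in> l2 (carrier G)"
  shows "l2_inner (carrier G) (lap f) g = l2_inner (carrier G) f (lap g)"
proof -
  have "cnj (l2_inner (carrier G) (shift s g) f) = l2_inner (carrier G) (shift (inv s) f) g"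
    if "s \<in> S" for s
    using shift_adjoint[OF S_memD[OF that], of g f]
      l2_inner_commute[of "carrier G" "shift (inv s) f" g] by simp
  then have "(\<Sum>s\<in>S. cnj (l2_inner (carrier G) (shift s g) f))
      = (\<Sum>s\<in>S. l2_inner (carrier G) (shift (inv s) f) g)" by simp
  also have "\<dots> = (\<Sum>s\<in>S. l2_inner (carrier G) (shift s f) g)"
    by (rule sum.reindex_bij_betw[OF bij_inv_S, of "\<lambda>s. l2_inner (carrier G) (shift s f) g"])
  finally show ?thesis
    using l2_inner_commute[of "carrier G" f "lap g"] l2_inner_commute[of "carrier G" f g]
    by (simp add: lap_inner f g)
qed

text \<open>The Dirichlet form: translations are isometric, so
  \<open>\<parallel>shift s f - f\<parallel>\<^sup>2\<close> expands to \<open>2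
  \<parallel>f\<parallel>\<^sup>2 - 2 Re \<langle>shift s f, f\<rangle>\<close>, and summing over
  \<open>S\<close> gives the Laplacian.\<close>

lemma lap_energy:
  assumes f: "f \<in> l2 (carrier G)"
  shows "Re (l2_inner (carrier G) (lap f) f)
     = (\<Sum>s\<in>S. (l2_norm (carrier G) (\<lambda>x. shift s f x - f x))\<^sup>2) / (2 * real (card S))"
proof -
  have "(l2_norm (carrier G) (\<lambda>x. shift s f x - f x))\<^sup>2
      = 2 * (l2_norm (carrier G) f)\<^sup>2 - 2 * Re (l2_inner (carrier G) (shift s f) f)" if "s \<in> S" for s
  proof -
    note sf = shift_l2[OF S_memD[OF that] f]
    have "complex_of_real ((l2_norm (carrier G) (\<lambda>x. shift s f x - f x))\<^sup>2)
        = l2_inner (carrier G) (shift s f) (shift s f) - l2_inner (carrier G) (shift s f) f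
          - (cnj (l2_inner (carrier G) (shift s f) f) - l2_inner (carrier G) f f)"
      unfolding l2_inner_self[OF l2_diff[OF sf f], symmetric]
      using l2_inner_commute[of "carrier G" f "shift s f"]
      by (simp add: l2_inner_diff_left l2_inner_diff_right l2_diff sf f)
    then have "Re (complex_of_real ((l2_norm (carrier G) (\<lambda>x. shift s f x - f x))\<^sup>2))
        = Re (l2_inner (carrier G) (shift s f) (shift s f) - l2_inner (carrier G) (shift s f) f
          - (cnj (l2_inner (carrier G) (shift s f) f) - l2_inner (carrier G) f f))" by simp
    then show ?thesis
      by (simp add: l2_inner_self sf f l2_norm_shift S_memD[OF that] del: of_real_power)
  qed
  then have "(\<Sum>s\<in>S. (l2_norm (carrier G) (\<lambda>x. shift s f x - f x))\<^sup>2)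
      = 2 * real (card S) * (l2_norm (carrier G) f)\<^sup>2
        - 2 * (\<Sum>s\<in>S. Re (l2_inner (carrier G) (shift s f) f))"
    by (simp add: sum_subtractf sum_distrib_left)
  moreover have "Re (l2_inner (carrier G) (lap f) f) = (l2_norm (carrier G) f)\<^sup>2
      - (\<Sum>s\<in>S. Re (l2_inner (carrier G) (shift s f) f)) / real (card S)"
  proof -
    have "Re ((1 / of_nat (card S)) * z) = Re z / real (card S)" for z :: complex
      by (simp add: Re_divide_of_nat)
    then show ?thesis by (simp add: lap_inner[OF f f] l2_inner_self[OF f] Re_divide_of_nat del: of_real_power)
  qed
  ultimately show ?thesis using card_S_pos by (simp add: field_simps)
qed

text \<open>The energy formula gives the lower bound 0. The upper bound 2 follows from the
  parallelogram law, by which each translation difference has squared norm at most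
  \<open>4 \<parallel>f\<parallel>\<^sup>2\<close>.\<close>

sublocale lap: l2_positive_operator "carrier G" lap 2
proof
  show "lap (\<lambda>x. f x + g x) = (\<lambda>x. lap f x + lap g x)" for f g
  proof -
    have "shift s (\<lambda>x. f x + g x) = (\<lambda>x. shift s f x + shift s g x)" for s
      by (simp add: shift_def fun_eq_iff)
    then show ?thesis by (simp add: lap_eq sum.distrib add_divide_distrib fun_eq_iff)
  qed
  show "lap (\<lambda>x. b * f x) = (\<lambda>x. b * lap f x)" for b f
  proof -
    have "shift s (\<lambda>x. b * f x) = (\<lambda>x. b * shift s f x)" for s
      by (simp add: shift_def fun_eq_iff)
    then show ?thesis
      by (simp add: lap_eq sum_distrib_left[symmetric] right_diff_distrib fun_eq_iff)
  qed
  show "lap f \<in> l2 (carrier G)" if "f \<in> l2 (carrier G)" for f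
    unfolding lap_eq by (intro l2_diff that average_l2)
  show "l2_inner (carrier G) (lap f) g = l2_inner (carrier G) f (lap g)"
    if "f \<in> l2 (carrier G)" "g \<in> l2 (carrier G)" for f g by (rule lap_symmetric[OF that])
  show "0 \<le> Re (l2_inner (carrier G) (lap f) f)" if "f \<in> l2 (carrier G)" for f
    unfolding lap_energy[OF that] by (intro divide_nonneg_nonneg sum_nonneg) auto
  show "Re (l2_inner (carrier G) (lap f) f) \<le> 2 * (l2_norm (carrier G) f)\<^sup>2"
    if f: "f \<in> l2 (carrier G)" for f
  proof -
    have "(l2_norm (carrier G) (\<lambda>x. shift s f x - f x))\<^sup>2 \<le> 4 * (l2_norm (carrier G) f)\<^sup>2"
      if "s \<in> S" for s
    proof -
      note sf = shift_l2[OF S_memD[OF that] f]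
      have "complex_of_real ((l2_norm (carrier G) (\<lambda>x. shift s f x + f x))\<^sup>2
          + (l2_norm (carrier G) (\<lambda>x. shift s f x - f x))\<^sup>2)
          = complex_of_real (4 * (l2_norm (carrier G) f)\<^sup>2)"
        unfolding of_real_add l2_inner_self[OF l2_diff[OF sf f], symmetric]
          l2_inner_self[OF l2_add[OF sf f], symmetric]
        by (simp add: l2_inner_diff_left l2_inner_diff_right l2_inner_add_left l2_inner_add_right
            l2_diff l2_add sf f l2_inner_self l2_norm_shift S_memD[OF that])
      then have "(l2_norm (carrier G) (\<lambda>x. shift s f x + f x))\<^sup>2
          + (l2_norm (carrier G) (\<lambda>x. shift s f x - f x))\<^sup>2 = 4 * (l2_norm (carrier G) f)\<^sup>2"
        by (simp only: of_real_eq_iff)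
      then show ?thesis
        using zero_le_power2[of "l2_norm (carrier G) (\<lambda>x. shift s f x + f x)"] by linarith
    qed
    then have "(\<Sum>s\<in>S. (l2_norm (carrier G) (\<lambda>x. shift s f x - f x))\<^sup>2)
        \<le> (\<Sum>s\<in>S. 4 * (l2_norm (carrier G) f)\<^sup>2)" by (rule sum_mono)
    then show ?thesis unfolding lap_energy[OF f] using card_S_pos by (simp add: field_simps)
  qed
qed simp

text \<open>The induction peels off the lowest level set of \<open>w\<close>.\<close>

lemma coarea:
  assumes "finite \<Omega>" and "0 \<le> r" and "\<And>x. 0 \<le> w x" and "{x. w x \<noteq> 0} \<subseteq> \<Omega>" and \<Omega>: "\<Omega> \<subseteq> carrier G"
    and iso: "\<And>U. U \<subseteq> \<Omega> \<Longrightarrow> U \<noteq> {} \<Longrightarrow> real (card U) \<le> r * real (card (inner_boundary G S U))"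
  shows "(\<Sum>x\<in>\<Omega>. w x) \<le> r * (\<Sum>x\<in>\<Omega>. \<Sum>s\<in>S. max 0 (w x - w (x \<otimes> s)))"
  using assms(3,4)
proof (induction "card {x. w x \<noteq> 0}" arbitrary: w rule: less_induct)
  case less
  define U where "U = {x. w x \<noteq> 0}"
  have U: "U \<subseteq> \<Omega>" "finite U" using less.prems(2) finite_subset[OF _ \<open>finite \<Omega>\<close>] by (auto simp: U_def)
  show ?case
  proof (cases "U = {}")
    case True
    then have "(\<Sum>x\<in>\<Omega>. w x) = 0" by (simp add: U_def)
    moreover have "0 \<le> r * (\<Sum>x\<in>\<Omega>. \<Sum>s\<in>S. max 0 (w x - w (x \<otimes> s)))"
      using \<open>0 \<le> r\<close> by (intro mult_nonneg_nonneg sum_nonneg) auto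
    ultimately show ?thesis by linarith
  next
    case False
    define m where "m = Min (w ` U)"
    have m_in: "m \<in> w ` U" unfolding m_def by (rule Min_in) (use U False in auto)
    then obtain y where y: "y \<in> U" "w y = m" by blast
    have m_pos: "0 < m" using y less.prems(1)[of y] by (auto simp: U_def less_le)
    have m_le: "m \<le> w x" if "x \<in> U" for x unfolding m_def using U that by simp
    define w' where "w' x = (if x \<in> U then w x - m else 0)" for x
    have w_out: "w x = 0" if "x \<notin> U" for x using that by (simp add: U_def)
    \<comment> \<open>The point \<open>y\<close>, where the minimum is attained, leaves the
      support.\<close>
    have sub: "{x. w' x \<noteq> 0} \<subset> U" using y by (auto simp: w'_def)
    have IH: "(\<Sum>x\<in>\<Omega>. w' x) \<le> r * (\<Sum>x\<in>\<Omega>. \<Sum>s\<in>S. max 0 (w' x - w' (x \<otimes> s)))"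
    proof (rule less.hyps)
      show "card {x. w' x \<noteq> 0} < card {x. w x \<noteq> 0}"
        using psubset_card_mono[OF U(2) sub] by (simp add: U_def)
      show "0 \<le> w' x" for x using m_le by (simp add: w'_def)
      show "{x. w' x \<noteq> 0} \<subseteq> \<Omega>" using sub U by auto
    qed
    \<comment> \<open>Removing the layer of height \<open>m\<close> never increases an outgoing
      difference, and lowers one by exactly \<open>m\<close> across an edge leaving
      \<open>U\<close>.\<close>
    have step: "(\<Sum>s\<in>S. max 0 (w' x - w' (x \<otimes> s))) + (if x \<in> inner_boundary G S U then m else 0)
        \<le> (\<Sum>s\<in>S. max 0 (w x - w (x \<otimes> s)))" for x
    proof -
      have le: "max 0 (w' x - w' (x \<otimes> s)) \<le> max 0 (w x - w (x \<otimes> s))" for s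
        using m_pos m_le[of x] m_le[of "x \<otimes> s"] w_out[of "x \<otimes> s"] by (auto simp: w'_def)
      show ?thesis
      proof (cases "x \<in> inner_boundary G S U")
        case True
        then obtain s where s: "s \<in> S" "x \<otimes> s \<notin> U" and x: "x \<in> U"
          by (auto simp: inner_boundary_def)
        have "max 0 (w' x - w' (x \<otimes> s)) + m \<le> max 0 (w x - w (x \<otimes> s))"
          using s x w_out[of "x \<otimes> s"] m_le[OF x] m_pos by (simp add: w'_def)
        moreover have "(\<Sum>s\<in>S - {s}. max 0 (w' x - w' (x \<otimes> s)))
            \<le> (\<Sum>s\<in>S - {s}. max 0 (w x - w (x \<otimes> s)))" by (intro sum_mono le)
        ultimately show ?thesis
          using True by (simp add: sum.remove[OF finite_S s(1)])
      qed (use sum_mono[OF le] in simp)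
    qed
    have bdry: "inner_boundary G S U \<subseteq> U" by (auto simp: inner_boundary_def)
    \<comment> \<open>The induction hypothesis handles \<open>w'\<close>, the isoperimetric
      hypothesis for \<open>U\<close> handles the removed layer.\<close>
    have "(\<Sum>x\<in>\<Omega>. w x) = (\<Sum>x\<in>\<Omega>. w' x + (if x \<in> U then m else 0))"
      by (rule sum.cong) (auto simp: w'_def w_out)
    also have "\<dots> = (\<Sum>x\<in>\<Omega>. w' x) + m * real (card U)"
      using U \<open>finite \<Omega>\<close> by (simp add: sum.distrib sum.If_cases Int_absorb1)
    also have "\<dots> \<le> r * (\<Sum>x\<in>\<Omega>. \<Sum>s\<in>S. max 0 (w' x - w' (x \<otimes> s)))
        + m * (r * real (card (inner_boundary G S U)))"
      using IH iso[OF U(1) False] m_pos by (intro add_mono mult_left_mono) auto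
    also have "\<dots> = r * (\<Sum>x\<in>\<Omega>. (\<Sum>s\<in>S. max 0 (w' x - w' (x \<otimes> s)))
        + (if x \<in> inner_boundary G S U then m else 0))"
      using U bdry \<open>finite \<Omega>\<close>
      by (simp add: sum.distrib sum.If_cases Int_absorb1 subset_trans[OF bdry U(1)] algebra_simps)
    also have "\<dots> \<le> r * (\<Sum>x\<in>\<Omega>. \<Sum>s\<in>S. max 0 (w x - w (x \<otimes> s)))"
      using \<open>0 \<le> r\<close> by (intro mult_left_mono sum_mono step) auto
    finally show ?thesis .
  qed
qed

section \<open>Cheeger's inequality and its Nash-type consequence\<close>

text \<open>Apply \<open>coarea\<close> to \<open>h\<^sup>2\<close>, split the differences of
  squares by a weighted arithmetic-geometric mean inequality, and absorb the part proportional to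
  the norm into the left-hand side.\<close>

lemma cheeger:
  fixes h :: "'a \<Rightarrow> real"
  assumes fin: "finite \<Omega>" and \<Omega>: "\<Omega> \<subseteq> carrier G" and r: "0 < r"
    and h_nonneg: "\<And>x. 0 \<le> h x" and h_supp: "\<And>x. x \<notin> \<Omega> \<Longrightarrow> h x = 0"
    and iso: "\<And>U. U \<subseteq> \<Omega> \<Longrightarrow> U \<noteq> {} \<Longrightarrow> real (card U) \<le> r * real (card (inner_boundary G S U))"
  shows "(l2_norm (carrier G) (\<lambda>x. complex_of_real (h x)))\<^sup>2
     \<le> 8 * r\<^sup>2 * (real (card S))\<^sup>2 * 
         Re (l2_inner (carrier G) (lap (\<lambda>x. complex_of_real (h x))) (\<lambda>x. complex_of_real (h x)))"
proof -
  define f where "f x = complex_of_real (h x)" for x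
  have f: "f \<in> l2 (carrier G)" by (rule l2_finite_support[OF fin \<Omega>]) (simp add: f_def h_supp)
  define H where "H = (l2_norm (carrier G) f)\<^sup>2"
  define D where "D s = (l2_norm (carrier G) (\<lambda>x. shift s f x - f x))\<^sup>2" for s
  define n where "n = real (card S)"
  have n: "0 < n" using card_S_pos by (simp add: n_def)
  have H_sum: "(\<Sum>x\<in>\<Omega>. (h x)\<^sup>2) = H"
  proof -
    have "H = (\<Sum>\<^sub>\<infinity>x\<in>\<Omega>. (cmod (f x))\<^sup>2)"
      unfolding H_def l2_norm_sq
      by (rule infsum_cong_neutral) (use \<Omega> h_supp in \<open>auto simp: f_def\<close>)
    then show ?thesis using fin by (simp add: f_def)
  qed
  have H_shift: "(\<Sum>x\<in>\<Omega>. (h (x \<otimes> s))\<^sup>2) \<le> H" if "s \<in> S" for s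
  proof -
    have "(\<Sum>x\<in>\<Omega>. (h (x \<otimes> s))\<^sup>2) = (\<Sum>x\<in>\<Omega>. (cmod (shift s f x))\<^sup>2)"
      by (rule sum.cong) (use \<Omega> in \<open>auto simp: shift_def f_def\<close>)
    then show ?thesis
      using l2_norm_finite_sum_le[OF shift_l2[OF S_memD[OF that] f] fin \<Omega>]
      by (simp add: H_def l2_norm_shift[OF S_memD[OF that] f])
  qed
  have D_sum: "(\<Sum>x\<in>\<Omega>. (h x - h (x \<otimes> s))\<^sup>2) \<le> D s" if "s \<in> S" for s
  proof -
    have "(\<Sum>x\<in>\<Omega>. (h x - h (x \<otimes> s))\<^sup>2) = (\<Sum>x\<in>\<Omega>. (cmod (shift s f x - f x))\<^sup>2)"
      by (rule sum.cong) (use \<Omega> in \<open>auto simp: shift_def f_def power2_commute simp flip: of_real_diff\<close>)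
    then show ?thesis
      using l2_norm_finite_sum_le[OF l2_diff[OF shift_l2[OF S_memD[OF that] f] f] fin \<Omega>]
      by (simp add: D_def)
  qed
  \<comment> \<open>This weight makes the error term \<open>r * n * (2 * H / t)\<close> equal to
    \<open>H / 2\<close>.\<close>
  define t where "t = 4 * r * n"
  have t: "0 < t" using r n by (simp add: t_def)
  have pointwise: "max 0 (a\<^sup>2 - b\<^sup>2) \<le> t / 2 * (a - b)\<^sup>2 + (a\<^sup>2 + b\<^sup>2) / t"
    if "0 \<le> a" "0 \<le> b" for a b :: real
  proof -
    have "0 \<le> (t * (a - b) - (a + b))\<^sup>2 / (2 * t)" using t by simp
    also have "(t * (a - b) - (a + b))\<^sup>2 / (2 * t)
        = t / 2 * (a - b)\<^sup>2 + (a + b)\<^sup>2 / (2 * t) - (a\<^sup>2 - b\<^sup>2)"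
      using t by (simp add: field_simps power2_eq_square)
    finally have "a\<^sup>2 - b\<^sup>2 \<le> t / 2 * (a - b)\<^sup>2 + (a + b)\<^sup>2 / (2 * t)" by simp
    moreover have "(a + b)\<^sup>2 / (2 * t) \<le> (a\<^sup>2 + b\<^sup>2) / t"
    proof -
      have "(a + b)\<^sup>2 \<le> 2 * (a\<^sup>2 + b\<^sup>2)"
        using zero_le_power2[of "a - b"] by (simp add: algebra_simps power2_eq_square)
      then have "(a + b)\<^sup>2 / (2 * t) \<le> 2 * (a\<^sup>2 + b\<^sup>2) / (2 * t)"
        using t by (intro divide_right_mono) auto
      also have "2 * (a\<^sup>2 + b\<^sup>2) / (2 * t) = (a\<^sup>2 + b\<^sup>2) / t"
        by (rule mult_divide_mult_cancel_left) simp
      finally show ?thesis .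
    qed
    moreover have "0 \<le> t / 2 * (a - b)\<^sup>2 + (a\<^sup>2 + b\<^sup>2) / t" using t by simp
    ultimately show ?thesis by simp
  qed
  have "H \<le> r * (\<Sum>x\<in>\<Omega>. \<Sum>s\<in>S. max 0 ((h x)\<^sup>2 - (h (x \<otimes> s))\<^sup>2))"
    unfolding H_sum[symmetric]
    by (rule coarea[OF fin _ _ _ \<Omega> iso]) (use r h_supp in auto)
  also have "\<dots> = r * (\<Sum>s\<in>S. \<Sum>x\<in>\<Omega>. max 0 ((h x)\<^sup>2 - (h (x \<otimes> s))\<^sup>2))"
    by (subst sum.swap) simp
  also have "\<dots> \<le> r * (\<Sum>s\<in>S. t / 2 * D s + 2 * H / t)"
  proof (intro mult_left_mono sum_mono)
    fix s assume s: "s \<in> S"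
    have "(\<Sum>x\<in>\<Omega>. max 0 ((h x)\<^sup>2 - (h (x \<otimes> s))\<^sup>2))
        \<le> (\<Sum>x\<in>\<Omega>. t / 2 * (h x - h (x \<otimes> s))\<^sup>2 + ((h x)\<^sup>2 + (h (x \<otimes> s))\<^sup>2) / t)"
      by (intro sum_mono pointwise h_nonneg)
    also have "\<dots> = t / 2 * (\<Sum>x\<in>\<Omega>. (h x - h (x \<otimes> s))\<^sup>2)
        + ((\<Sum>x\<in>\<Omega>. (h x)\<^sup>2) + (\<Sum>x\<in>\<Omega>. (h (x \<otimes> s))\<^sup>2)) / t"
      by (simp add: sum.distrib sum_distrib_left add_divide_distrib sum_divide_distrib)
    also have "\<dots> \<le> t / 2 * D s + (H + H) / t"
      using t D_sum[OF s] H_shift[OF s] H_sum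
      by (intro add_mono mult_left_mono divide_right_mono) auto
    finally show "(\<Sum>x\<in>\<Omega>. max 0 ((h x)\<^sup>2 - (h (x \<otimes> s))\<^sup>2)) \<le> t / 2 * D s + 2 * H / t" by simp
  qed (use r in simp)
  also have "\<dots> = r * (t / 2 * (\<Sum>s\<in>S. D s) + n * (2 * H / t))"
    by (simp add: sum.distrib sum_distrib_left n_def)
  also have "(\<Sum>s\<in>S. D s) = 2 * n * Re (l2_inner (carrier G) (lap f) f)"
    unfolding lap_energy[OF f] D_def using n by (simp add: n_def)
  also have "r * (t / 2 * (2 * n * Re (l2_inner (carrier G) (lap f) f)) + n * (2 * H / t))
      = 4 * r\<^sup>2 * n\<^sup>2 * Re (l2_inner (carrier G) (lap f) f) + H / 2"
    using r n by (simp add: t_def field_simps power2_eq_square)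
  finally show ?thesis by (simp add: H_def f_def[abs_def] n_def)
qed

text \<open>Nash-type step: truncating \<open>g\<close> at height \<open>\<parallel>g\<parallel>\<^sup>2 / 4\<close> keeps half of the mass
  and leaves a support of size at most \<open>4 / \<parallel>g\<parallel>\<^sup>2\<close>.\<close>

lemma nash_step:
  fixes g :: "'a \<Rightarrow> real"
  defines "f \<equiv> (\<lambda>x. complex_of_real (g x))"
  assumes f: "f \<in> l2 (carrier G)" and g_nonneg: "\<And>x. 0 \<le> g x" and g_sum: "(g has_sum 1) (carrier G)"
    and r: "0 < r" and large: "4 < real (folner G S r) * (l2_norm (carrier G) f)\<^sup>2"
  shows "(l2_norm (carrier G) f)\<^sup>2
      \<le> 16 * r\<^sup>2 * (real (card S))\<^sup>2 * Re (l2_inner (carrier G) (lap f) f)"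
proof -
  define u where "u = (l2_norm (carrier G) f)\<^sup>2"
  have u: "0 < u" using large by (cases "u = 0") (auto simp: u_def less_le)
  define a where "a = u / 4"
  have a: "0 < a" using u by (simp add: a_def)
  define h where "h x = max 0 (g x - a)" for x
  define k where "k x = complex_of_real (h x)" for x
  define \<Omega> where "\<Omega> = {x. a < g x}"
  have g_out: "g x = 0" if "x \<notin> carrier G" for x using l2_outside[OF f that] by (simp add: f_def)
  have \<Omega>: "\<Omega> \<subseteq> carrier G" using g_out a by (force simp: \<Omega>_def)
  \<comment> \<open>Markov's inequality, as \<open>g\<close> has total mass 1. Only finite subsets
    are counted, since finiteness of \<open>\<Omega>\<close> is derived from this bound.\<close>
  have card_le: "real (card B) \<le> 4 / u" if B: "B \<subseteq> \<Omega>" "finite B" for B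
  proof -
    have "real (card B) * a \<le> (\<Sum>x\<in>B. g x)"
      using B sum_mono[of B "\<lambda>_. a" g] by (force simp: \<Omega>_def)
    also have "\<dots> \<le> 1"
      by (rule finite_sum_le_has_sum[OF g_sum]) (use B \<Omega> g_nonneg in auto)
    finally show ?thesis using u by (simp add: a_def field_simps)
  qed
  have fin: "finite \<Omega>"
    using finite_if_finite_subsets_card_bdd[of \<Omega> "nat \<lceil>4 / u\<rceil>"] card_le
    by (meson le_nat_iff of_nat_ceiling order_trans real_nat_ceiling_ge of_nat_le_iff)
  \<comment> \<open>A set violating this competes in the minimum defining
    \<open>folner G S r\<close> but has at most \<open>4 / u\<close> elements, contradicting
    \<open>large\<close>.\<close>
  have iso: "real (card U) \<le> r * real (card (inner_boundary G S U))" if U: "U \<subseteq> \<Omega>" "U \<noteq> {}" for U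
  proof (rule ccontr)
    assume neg: "\<not> ?thesis"
    have finU: "finite U" using U fin finite_subset by blast
    then have "0 < card U" using U by (simp add: card_gt_0_iff)
    with neg r have "real (card (inner_boundary G S U)) / real (card U) < 1 / r"
      by (simp add: field_simps)
    then have "folner G S r \<le> card U"
      unfolding folner_def using U \<Omega> finU by (intro Least_le) blast
    with card_le[OF U(1) finU] have "real (folner G S r) \<le> 4 / u" by linarith
    with large u show False by (simp add: u_def[symmetric] field_simps)
  qed
  \<comment> \<open>Truncation is a contraction, so by \<open>lap_energy\<close> it does not
    increase the Dirichlet energy.\<close>
  have h_le: "\<bar>h x - h y\<bar> \<le> \<bar>g x - g y\<bar>" for x y by (auto simp: h_def)
  have k: "k \<in> l2 (carrier G)"
    by (rule l2_norm_mono(1)[OF f]) (use g_nonneg a g_out in \<open>auto simp: k_def h_def f_def\<close>)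
  have "u / 2 \<le> (l2_norm (carrier G) k)\<^sup>2"
  proof -
    have sq: "(\<lambda>x. (g x)\<^sup>2) summable_on carrier G" "(\<lambda>x. (h x)\<^sup>2) summable_on carrier G"
      using l2_summable[OF f] l2_summable[OF k] by (simp_all add: f_def k_def)
    have g_summable: "(\<lambda>x. - (2 * a) * g x) summable_on carrier G"
      by (rule summable_on_cmult_right[OF has_sum_imp_summable[OF g_sum]])
    \<comment> \<open>With total mass 1 and \<open>a = u / 4\<close>, the sum of
      \<open>g\<^sup>2 - 2 a g\<close> is \<open>u - u / 2\<close>; pointwise it lies below
      \<open>h\<^sup>2\<close>.\<close>
    have "u / 2 = (\<Sum>\<^sub>\<infinity>x\<in>carrier G. (g x)\<^sup>2) + (\<Sum>\<^sub>\<infinity>x\<in>carrier G. - (2 * a) * g x)"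
      using infsumI[OF g_sum] infsum_cmult_right'[of "- (2 * a)" g "carrier G"]
      by (simp add: u_def l2_norm_sq f_def a_def)
    also have "\<dots> = (\<Sum>\<^sub>\<infinity>x\<in>carrier G. (g x)\<^sup>2 + - (2 * a) * g x)"
      by (rule infsum_add[OF sq(1) g_summable, symmetric])
    also have "\<dots> \<le> (\<Sum>\<^sub>\<infinity>x\<in>carrier G. (h x)\<^sup>2)"
    proof (rule infsum_mono[OF summable_on_add[OF sq(1) g_summable] sq(2)])
      fix x
      show "(g x)\<^sup>2 + - (2 * a) * g x \<le> (h x)\<^sup>2"
      proof (cases "g x \<le> a")
        case True
        then have "g x * g x \<le> 2 * a * g x"
          using g_nonneg[of x] a by (intro mult_right_mono) auto
        with True show ?thesis by (simp add: h_def power2_eq_square)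
      next
        case False
        then show ?thesis by (simp add: h_def power2_eq_square algebra_simps)
      qed
    qed
    also have "\<dots> = (l2_norm (carrier G) k)\<^sup>2" by (simp add: l2_norm_sq k_def)
    finally show ?thesis .
  qed
  also have "\<dots> \<le> 8 * r\<^sup>2 * (real (card S))\<^sup>2 * Re (l2_inner (carrier G) (lap k) k)"
    unfolding k_def[abs_def]
    by (rule cheeger[OF fin \<Omega> r _ _ iso]) (auto simp: h_def \<Omega>_def)
  also have "\<dots> \<le> 8 * r\<^sup>2 * (real (card S))\<^sup>2 * Re (l2_inner (carrier G) (lap f) f)"
  proof (rule mult_left_mono)
    show "Re (l2_inner (carrier G) (lap k) k) \<le> Re (l2_inner (carrier G) (lap f) f)"
      unfolding lap_energy[OF k] lap_energy[OF f]
    proof (intro divide_right_mono sum_mono)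
      fix s assume s: "s \<in> S"
      show "(l2_norm (carrier G) (\<lambda>x. shift s k x - k x))\<^sup>2
          \<le> (l2_norm (carrier G) (\<lambda>x. shift s f x - f x))\<^sup>2"
        by (rule l2_norm_mono(2)[OF l2_diff[OF shift_l2[OF S_memD[OF s] f] f]])
           (use h_le l2_outside[OF k] in \<open>auto simp: shift_def k_def f_def simp flip: of_real_diff\<close>)
    qed simp
  qed simp
  finally show ?thesis by (simp add: u_def)
qed

end

subsection \<open>Decay of the lazy random walk\<close>

lemma has_sum_finite_sum:
  fixes F :: "'i \<Rightarrow> 'b \<Rightarrow> 'c :: topological_comm_monoid_add"
  assumes "\<And>i. i \<in> I \<Longrightarrow> (F i has_sum c i) A"
  shows "((\<lambda>x. \<Sum>i\<in>I. F i x) has_sum (\<Sum>i\<in>I. c i)) A"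
  using assms by (induction I rule: infinite_finite_induct) (auto intro: has_sum_add)

text \<open>On the unit interval \<open>(1 - x/2) (1 + x) = 1 + x (1 - x) / 2\<close> is at least 1,
  and \<open>1 + x \<le> exp x\<close>.\<close>

lemma exp_minus_le_one_minus_half:
  fixes x :: real
  assumes "0 \<le> x" and "x \<le> 1"
  shows "exp (- x) \<le> 1 - x / 2"
proof -
  have "1 \<le> (1 - x / 2) * (1 + x)"
    using assms mult_left_le[of x x] by (simp add: algebra_simps)
  also have "\<dots> \<le> (1 - x / 2) * exp x"
    using assms exp_ge_add_one_self[of x] by (intro mult_left_mono) auto
  finally show ?thesis by (simp add: exp_minus field_simps)
qed

context symmetric_generators
begin

text \<open>The polynomial whose value at the Laplacian is the lazy walk operator: stay with
  probability 1/2, else make a uniform step.\<close>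

definition lazy_step :: "real poly" where "lazy_step = [:1, -1/2:]"

text \<open>By symmetry of the walk operator, this is the probability that the lazy walk is back at
  the start after \<open>2 * n\<close> steps.\<close>

definition return_prob :: "nat \<Rightarrow> real" where
  "return_prob n = (l2_norm (carrier G) (lap.op_poly (lazy_step ^ n) (l2_delta \<one>)))\<^sup>2"

lemma delta_l2: "l2_delta \<one> \<in> l2 (carrier G)" by (simp add: l2_delta_in_l2)

text \<open>One lazy step is a convex combination of a function and its translates, so it preserves
  nonnegativity and total mass.\<close>

lemma lazy_walk_density:
  "\<exists>g :: 'a \<Rightarrow> real. lap.op_poly (lazy_step ^ n) (l2_delta \<one>) = (\<lambda>x. complex_of_real (g x))
     \<and> (\<forall>x. 0 \<le> g x) \<and> (g has_sum 1) (carrier G)"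
proof (induction n)
  case 0
  have "((\<lambda>x. if x = \<one> then 1 else 0 :: real) has_sum 1) (carrier G)"
    by (rule has_sum_finite_neutralI[of "{\<one>}"]) auto
  then show ?case
    by (intro exI[of _ "\<lambda>x. if x = \<one> then 1 else 0"])
       (auto simp: lap.op_poly_1 l2_delta_def fun_eq_iff)
next
  case (Suc n)
  then obtain g :: "'a \<Rightarrow> real"
    where g: "lap.op_poly (lazy_step ^ n) (l2_delta \<one>) = (\<lambda>x. complex_of_real (g x))"
    "\<And>x. 0 \<le> g x" "(g has_sum 1) (carrier G)" by blast
  define sg where "sg s x = (if x \<in> carrier G then g (x \<otimes> s) else 0)" for s x
  define g' where "g' x = 1 / 2 * g x + 1 / (2 * real (card S)) * (\<Sum>s\<in>S. sg s x)" for x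
  have "lap.op_poly (lazy_step ^ Suc n) (l2_delta \<one>) = (\<lambda>x. complex_of_real (g' x))"
  proof -
    have "shift s (\<lambda>x. complex_of_real (g x)) x = complex_of_real (sg s x)" for s x
      by (simp add: shift_def sg_def)
    moreover have "lap.op_poly (lazy_step ^ Suc n) (l2_delta \<one>)
        = lap.op_poly lazy_step (\<lambda>x. complex_of_real (g x))"
      by (simp only: power_Suc lap.op_poly_mult g(1))
    ultimately show ?thesis
      unfolding lazy_step_def lap.op_poly_degree_1 lap_eq g'_def
      by (simp add: fun_eq_iff algebra_simps)
  qed
  moreover have "0 \<le> g' x" for x
    unfolding g'_def sg_def using g(2) by (intro add_nonneg_nonneg mult_nonneg_nonneg sum_nonneg) auto
  moreover have "(g' has_sum 1) (carrier G)"
  proof -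
    have "(sg s has_sum 1) (carrier G)" if "s \<in> S" for s
    proof -
      have "((\<lambda>x. g (x \<otimes> s)) has_sum 1) (carrier G)"
        using has_sum_reindex_bij_betw[OF bij_right_mult[OF S_memD[OF that]], of g 1] g(3) by simp
      then show ?thesis by (rule has_sum_cong[THEN iffD1, rotated]) (simp add: sg_def)
    qed
    then have "((\<lambda>x. \<Sum>s\<in>S. sg s x) has_sum (\<Sum>s\<in>S. 1)) (carrier G)"
      by (rule has_sum_finite_sum)
    from has_sum_add[OF has_sum_cmult_right[OF g(3), of "1 / 2"]
        has_sum_cmult_right[OF this, of "1 / (2 * real (card S))"]]
    show ?thesis using card_S_pos by (simp add: g'_def[abs_def])
  qed
  ultimately show ?case by blast
qed

text \<open>With \<open>P = \<Delta>/2\<close>, \<open>(1 - P)\<^sup>2 = 1 - P - P (1 - P)\<close>,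
  and the last product is positive by \<open>positive_poly_monomials\<close> for
  \<open>k = l = 1\<close>.\<close>

lemma lazy_step_energy:
  assumes f: "f \<in> l2 (carrier G)"
  shows "(l2_norm (carrier G) (lap.op_poly lazy_step f))\<^sup>2
     \<le> (l2_norm (carrier G) f)\<^sup>2 - Re (l2_inner (carrier G) (lap f) f) / 2"
proof -
  let ?P = "[:0, 1/2:] :: real poly"
  have "lazy_step * lazy_step = 1 - ?P - ?P * lazy_step"
    by (simp add: lazy_step_def one_pCons)
  then have "(l2_norm (carrier G) (lap.op_poly lazy_step f))\<^sup>2
      = Re (l2_inner (carrier G) (lap.op_poly (1 - ?P - ?P * lazy_step) f) f)"
    by (simp only: lap.op_poly_norm_sq[OF f])
  also have "\<dots> = (l2_norm (carrier G) f)\<^sup>2 - Re (l2_inner (carrier G) (lap.op_poly ?P f) f)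
      - Re (l2_inner (carrier G) (lap.op_poly (?P * lazy_step) f) f)"
    by (simp only: lap.op_poly_diff l2_inner_diff_left l2_diff lap.op_poly_l2 f lap.op_poly_1
        minus_complex.simps l2_inner_self[OF f] Re_complex_of_real)
  also have "Re (l2_inner (carrier G) (lap.op_poly ?P f) f) = Re (l2_inner (carrier G) (lap f) f) / 2"
  proof -
    have "lap.op_poly ?P f = (\<lambda>x. (1/2) * lap f x)" unfolding lap.op_poly_degree_1 by simp
    then show ?thesis by (simp only: l2_inner_scale_left) simp
  qed
  finally show ?thesis
    using lap.positive_poly_monomials[of 1 1] f
    by (simp add: lap.positive_poly_def lazy_step_def)
qed

text \<open>Above the threshold \<open>4 / Fol(r)\<close>, \<open>nash_step\<close> shrinks the
  squared norm by a fixed factor; once below, energy positivity keeps it there.\<close>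

lemma return_prob_decay:
  assumes r: "0 < r" and "0 < folner G S r"
  shows "return_prob n
     \<le> max (4 / real (folner G S r)) ((1 - 1 / (32 * r\<^sup>2 * (real (card S))\<^sup>2)) ^ n)"
proof (induction n)
  case 0
  have "complex_of_real (return_prob 0) = 1"
    unfolding return_prob_def using l2_inner_self[OF delta_l2] l2_inner_delta_right[OF delta_l2 one_closed]
    by (simp add: lap.op_poly_1 l2_delta_def)
  then show ?case by simp
next
  case (Suc n)
  define v where "v = 4 / real (folner G S r)"
  define \<kappa> where "\<kappa> = 1 / (32 * r\<^sup>2 * (real (card S))\<^sup>2)"
  define f where "f = lap.op_poly (lazy_step ^ n) (l2_delta \<one>)"
  have f: "f \<in> l2 (carrier G)" unfolding f_def by (rule lap.op_poly_l2[OF delta_l2])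
  have u: "return_prob n = (l2_norm (carrier G) f)\<^sup>2" by (simp add: return_prob_def f_def)
  have step: "return_prob (Suc n) \<le> return_prob n - Re (l2_inner (carrier G) (lap f) f) / 2"
    unfolding u using lazy_step_energy[OF f] by (simp add: return_prob_def f_def lap.op_poly_mult)
  show ?case
  proof (cases "return_prob n \<le> v")
    case True
    then show ?thesis using step lap.A_nonneg[OF f] by (simp add: v_def)
  next
    case False
    obtain g :: "'a \<Rightarrow> real"
      where g: "f = (\<lambda>x. complex_of_real (g x))" "\<And>x. 0 \<le> g x" "(g has_sum 1) (carrier G)"
      using lazy_walk_density[of n] unfolding f_def by blast
    have "4 < real (folner G S r) * (l2_norm (carrier G) f)\<^sup>2"
      using False assms(2) by (simp add: v_def u field_simps)
    then have "return_prob n \<le> 16 * r\<^sup>2 * (real (card S))\<^sup>2 * Re (l2_inner (carrier G) (lap f) f)"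
      unfolding u using nash_step[of g r] g f r by simp
    then have "\<kappa> * return_prob n \<le> Re (l2_inner (carrier G) (lap f) f) / 2"
      using r card_S_pos by (simp add: \<kappa>_def field_simps)
    with step have le: "return_prob (Suc n) \<le> (1 - \<kappa>) * return_prob n"
      by (simp add: algebra_simps)
    have "0 \<le> v" by (simp add: v_def)
    with False have pos: "0 < return_prob n" by linarith
    \<comment> \<open>That the contraction factor is nonnegative is read off from the nonnegativity
      of the next value.\<close>
    have "0 \<le> return_prob (Suc n)" by (simp add: return_prob_def)
    with le have "0 \<le> (1 - \<kappa>) * return_prob n" by linarith
    with pos have \<kappa>: "0 \<le> 1 - \<kappa>" by (simp add: zero_le_mult_iff)
    have "return_prob n \<le> (1 - \<kappa>) ^ n" using Suc.IH False by (simp add: v_def \<kappa>_def)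
    from mult_left_mono[OF this \<kappa>] le have "return_prob (Suc n) \<le> (1 - \<kappa>) ^ Suc n" by simp
    then show ?thesis by (simp add: \<kappa>_def)
  qed
qed

section \<open>From return probabilities to the spectral distribution\<close>

lemma spectral_distribution_eq:
  "spectral_distribution G (uniform_weight S) lam
     = measure (l2_spectral_measure (carrier G) lap (l2_delta \<one>)) {..lam}"
  by (simp add: spectral_distribution_def lap.functional_calculus_indicator[OF delta_l2])

lemma spectral_distribution_mono:
  assumes "lam \<le> lam'"
  shows "spectral_distribution G (uniform_weight S) lam \<le> spectral_distribution G (uniform_weight S) lam'"
  unfolding spectral_distribution_eq
  by (rule finite_measure.finite_measure_mono[OF lap.finite_spectral[OF delta_l2]])
     (use assms in \<open>auto simp: lap.sets_spectral[OF delta_l2]\<close>)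

text \<open>A Chebyshev bound: for \<open>x \<le> lam \<le> 2\<close> the integrand
  \<open>(1 - x/2) ^ (2 * n)\<close> is at least its value at \<open>lam\<close>.\<close>

lemma spectral_distribution_le_return_prob:
  assumes lam: "lam \<le> 2"
  shows "(1 - lam / 2) ^ (2 * n) * spectral_distribution G (uniform_weight S) lam \<le> return_prob n"
proof -
  define \<mu> where "\<mu> = l2_spectral_measure (carrier G) lap (l2_delta \<one>)"
  interpret finite_measure \<mu> unfolding \<mu>_def by (rule lap.finite_spectral[OF delta_l2])
  have sets: "sets \<mu> = sets borel" unfolding \<mu>_def by (rule lap.sets_spectral[OF delta_l2])
  have space: "space \<mu> = UNIV" using sets_eq_imp_space_eq[OF sets] by simp
  have AE: "AE x in \<mu>. \<bar>x\<bar> \<le> 2" unfolding \<mu>_def by (rule lap.AE_spectral[OF delta_l2])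
  have "(1 - lam / 2) ^ (2 * n) * measure \<mu> {..lam}
      = (\<integral>x. (1 - lam / 2) ^ (2 * n) * indicator {..lam} x \<partial>\<mu>)"
    by (simp add: space)
  also have "\<dots> \<le> (\<integral>x. (poly (lazy_step ^ n) x)\<^sup>2 \<partial>\<mu>)"
  proof (rule integral_mono)
    show "integrable \<mu> (\<lambda>x. (1 - lam / 2) ^ (2 * n) * indicator {..lam} x)"
      using sets by (intro integrable_mult_right integrable_real_indicator)
        (auto simp: emeasure_eq_measure)
    show "integrable \<mu> (\<lambda>x. (poly (lazy_step ^ n) x)\<^sup>2)"
      using integrable_poly[OF finite_measure_axioms sets AE, of "(lazy_step ^ n)\<^sup>2"]
      by (simp add: poly_power[abs_def])
    show "(1 - lam / 2) ^ (2 * n) * indicator {..lam} x \<le> (poly (lazy_step ^ n) x)\<^sup>2" for x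
    proof (cases "x \<le> lam")
      case True
      then have "(1 - lam / 2) ^ (2 * n) \<le> (1 - x / 2) ^ (2 * n)"
        using lam by (intro power_mono) auto
      with True show ?thesis
        by (simp add: lazy_step_def power_mult[symmetric] mult.commute[of n])
    qed simp
  qed
  also have "\<dots> = return_prob n"
    unfolding \<mu>_def return_prob_def by (rule lap.l2_norm_op_poly[OF delta_l2, symmetric])
  finally show ?thesis by (simp add: spectral_distribution_eq \<mu>_def)
qed

text \<open>The relation \<open>rl\<close> makes the decay rate of the return probability
  \<open>4 * lam\<close>, while \<open>(1 - lam/2) ^ (2 * n)\<close> decays at rate at most
  \<open>2 * lam\<close>. Stopping when the former reaches \<open>v = 4 / Fol(r)\<close> leaves the
  latter near \<open>sqrt v\<close>, so the quotient is of order \<open>sqrt v\<close>.\<close>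

lemma spectral_distribution_le_folner:
  assumes r: "0 < r" and lam: "0 < lam" "lam \<le> 1 / 4"
    and rl: "128 * r\<^sup>2 * (real (card S))\<^sup>2 * lam = 1" and fol: "4 \<le> folner G S r"
  shows "spectral_distribution G (uniform_weight S) lam * sqrt (real (folner G S r)) \<le> 2 * exp 2"
proof -
  define N where "N = spectral_distribution G (uniform_weight S) lam"
  define v where "v = 4 / real (folner G S r)"
  have v: "0 < v" "v \<le> 1" using fol by (simp_all add: v_def)
  define n where "n = nat \<lceil>ln (1 / v) / (4 * lam)\<rceil>"
  have ln_v: "0 \<le> ln (1 / v)" using v by simp
  have n: "ln (1 / v) / (4 * lam) \<le> real n" "real n \<le> ln (1 / v) / (4 * lam) + 1"
    unfolding n_def using ln_v lam by (simp_all add: real_nat_ceiling_ge of_nat_nat ceiling_correct)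
  have \<kappa>: "1 / (32 * r\<^sup>2 * (real (card S))\<^sup>2) = 4 * lam"
    using rl r card_S_pos by (simp add: field_simps)
  have "(1 - 4 * lam) ^ n \<le> exp (- (4 * lam)) ^ n"
    using lam exp_ge_add_one_self[of "- (4 * lam)"] by (intro power_mono) auto
  also have "\<dots> = exp (- (4 * lam * real n))" by (simp add: exp_of_nat_mult[symmetric] mult.commute)
  also have "\<dots> \<le> exp (- ln (1 / v))" using n(1) lam by (simp add: field_simps)
  also have "\<dots> = v" using v by (simp add: ln_div)
  finally have "return_prob n \<le> v"
    using return_prob_decay[OF r, of n] fol unfolding \<kappa> v_def by simp
  moreover have "exp (- 2) * sqrt v \<le> (1 - lam / 2) ^ (2 * n)"
  proof -
    \<comment> \<open>Rounding \<open>n\<close> up costs at most \<open>2 * lam\<close>, generously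
      bounded by 2; this is the source of the factor \<open>exp 2\<close>.\<close>
    have "2 * lam * real n \<le> ln (1 / v) / 2 + 2 * lam"
      using n(2) lam by (simp add: field_simps)
    also have "\<dots> \<le> 2 - ln v / 2" using lam v by (simp add: ln_div)
    finally have "exp (- 2 + ln v / 2) \<le> exp (- (2 * lam * real n))" by simp
    moreover have "exp (- 2) * sqrt v = exp (- 2 + ln v / 2)"
      using v by (simp only: exp_add) (simp add: powr_def powr_half_sqrt[symmetric])
    moreover have "exp (- (2 * lam * real n)) = exp (- lam) ^ (2 * n)"
      by (simp add: exp_of_nat_mult[symmetric] algebra_simps)
    moreover have "exp (- lam) ^ (2 * n) \<le> (1 - lam / 2) ^ (2 * n)"
      using lam by (intro power_mono exp_minus_le_one_minus_half) auto
    ultimately show ?thesis by linarith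
  qed
  moreover have "0 \<le> N" by (simp add: N_def spectral_distribution_eq)
  ultimately have "exp (- 2) * sqrt v * N \<le> v"
    using spectral_distribution_le_return_prob[of lam n] lam
      mult_right_mono[of "exp (- 2) * sqrt v" "(1 - lam / 2) ^ (2 * n)" N]
    by (simp add: N_def)
  also have "v = sqrt v * sqrt v" using v by simp
  finally have "sqrt v * (exp (- 2) * N) \<le> sqrt v * sqrt v" by (simp only: mult_ac)
  then have "exp (- 2) * N \<le> sqrt v" using v by (subst (asm) mult_le_cancel_left_pos) auto
  then have "N \<le> exp 2 * sqrt v" by (simp add: exp_minus field_simps)
  also have "sqrt v = 2 / sqrt (real (folner G S r))" by (simp add: v_def real_sqrt_divide)
  finally show ?thesis using fol by (simp add: N_def field_simps)
qed

end

section \<open>Absorbing square root and constants into a dilation\<close>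

theorem proposition1p6:
  fixes G :: "('a, 'b) monoid_scheme" and S :: "'a set"
    and F :: "real \<Rightarrow> real" and x\<^sub>0 :: real
  assumes "group G" and "infinite (carrier G)" and "amenable G"
    and "finite S" and "S \<subseteq> carrier G"
    and "\<forall>s\<in>S. inv\<^bsub>G\<^esub> s \<in> S" and "generate G S = carrier G"
    and "\<forall>r>x\<^sub>0. F r > 0"
    and "continuous_on {x\<^sub>0<..} F" and "strict_mono_on {x\<^sub>0<..} F"
    and "filterlim F at_top at_top"
    and "\<exists>C>1. \<forall>\<^sub>F r in at_top. (F r)\<^sup>2 \<le> F (C * r)"
    and "preceq_at_infinity F (\<lambda>r. real (folner G S r))"
  shows "dil_preceq_at_zero (spectral_distribution G (uniform_weight S))
           (\<lambda>lam. if lam = 0 then 0 else 1 / F (lam powr (-1/2)))"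
proof -
  \<comment> \<open>An empty set generates only the trivial group, which is finite.\<close>
  have "S \<noteq> {}"
    using assms(2,7) group.generate_empty[OF assms(1)] by (metis finite.emptyI finite.insertI)
  interpret symmetric_generators G S
    using assms \<open>S \<noteq> {}\<close>
    by (simp add: symmetric_generators_def symmetric_generators_axioms_def)
  let ?N = "spectral_distribution G (uniform_weight S)"
  define n where "n = real (card S)"
  have n: "0 < n" using card_S_pos by (simp add: n_def)
  obtain C\<^sub>0 D\<^sub>0 x\<^sub>1 where pre: "0 < C\<^sub>0" "0 < D\<^sub>0" "0 < x\<^sub>1"
    "\<And>x. x\<^sub>1 \<le> x \<Longrightarrow> F x \<le> C\<^sub>0 * real (folner G S (D\<^sub>0 * x))"
    using assms(13) unfolding preceq_at_infinity_def by blast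
  obtain C R where C: "1 < C" and R: "\<And>r. R \<le> r \<Longrightarrow> (F r)\<^sup>2 \<le> F (C * r)"
    using assms(12) unfolding eventually_at_top_linorder by blast
  \<comment> \<open>Once \<open>F z \<ge> K\<close>, the term \<open>4 * C\<^sub>0\<close> forces
    the Folner value to be at least 4, and the last term is the constant that one factor
    \<open>F z\<close> has to beat.\<close>
  define K where "K = 1 + 4 * C\<^sub>0 + 2 * exp 2 * sqrt C\<^sub>0"
  have K: "1 \<le> K" "4 * C\<^sub>0 \<le> K" "2 * exp 2 * sqrt C\<^sub>0 \<le> K" using pre by (simp_all add: K_def)
  \<comment> \<open>Chosen so that \<open>r = D\<^sub>0 * (C * (C * z))\<close> and
    \<open>lam = 1 / (D * z\<^sup>2)\<close> satisfy the relation required by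
    \<open>spectral_distribution_le_folner\<close>.\<close>
  define D where "D = 128 * n\<^sup>2 * D\<^sub>0\<^sup>2 * (C\<^sup>2)\<^sup>2"
  have D: "0 < D" using n pre C by (simp add: D_def)
  obtain Z\<^sub>0 where Z\<^sub>0: "\<And>z. Z\<^sub>0 \<le> z \<Longrightarrow> K \<le> F z"
    using assms(11) unfolding filterlim_at_top eventually_at_top_linorder by blast
  \<comment> \<open>The entry \<open>4 / D\<close> ensures \<open>lam \<le> 1 / 4\<close>.\<close>
  define Z where "Z = max 1 (max Z\<^sub>0 (max R (max x\<^sub>1 (4 / D))))"
  have key: "?N (1 / (D * z\<^sup>2)) \<le> 1 / F z" if z: "Z \<le> z" for z
  proof -
    have z': "1 \<le> z" "Z\<^sub>0 \<le> z" "R \<le> z" "x\<^sub>1 \<le> z" "4 / D \<le> z" using z by (simp_all add: Z_def)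
    have zC: "z \<le> C * z" "C * z \<le> C * (C * z)"
      using z' C mult_right_mono[of 1 C z] mult_right_mono[of 1 C "C * z"] by auto
    have Fz: "K \<le> F z" "1 \<le> F z" using Z\<^sub>0[OF z'(2)] K by linarith+
    \<comment> \<open>Two dilations by \<open>C\<close>, for two uses of condition (2): the fourth
      power of \<open>F z\<close> is below \<open>F y\<close>, so \<open>(F z)\<^sup>2\<close>
      remains after the square root.\<close>
    define y where "y = C * (C * z)"
    define r where "r = D\<^sub>0 * y"
    define lam where "lam = 1 / (D * z\<^sup>2)"
    have "((F z)\<^sup>2)\<^sup>2 \<le> (F (C * z))\<^sup>2"
      by (rule power_mono[OF R[OF z'(3)]]) simp
    also have "\<dots> \<le> F y" unfolding y_def by (rule R) (use z' zC in linarith)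
    finally have Fy: "((F z)\<^sup>2)\<^sup>2 \<le> F y" .
    have "F z \<le> (F z)\<^sup>2" by (rule self_le_power[OF Fz(2)]) simp
    moreover have "(F z)\<^sup>2 \<le> ((F z)\<^sup>2)\<^sup>2"
      by (rule self_le_power[OF one_le_power[OF Fz(2)]]) simp
    ultimately have "4 * C\<^sub>0 \<le> F y" using Fy Fz K by linarith
    have fol: "F y \<le> C\<^sub>0 * real (folner G S r)"
      unfolding r_def by (rule pre(4), unfold y_def) (use z' zC in linarith)
    with \<open>4 * C\<^sub>0 \<le> F y\<close> have "C\<^sub>0 * 4 \<le> C\<^sub>0 * real (folner G S r)" by linarith
    then have fol4: "4 \<le> folner G S r" using pre(1) by simp
    have r: "0 < r" using pre C z' by (simp add: r_def y_def)
    have "4 \<le> D * z" using z'(5) D by (simp add: field_simps)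
    also have "\<dots> \<le> D * z\<^sup>2" using D z' by (intro mult_left_mono) (simp_all add: power2_eq_square)
    finally have lam: "0 < lam" "lam \<le> 1 / 4" using D z' by (simp_all add: lam_def field_simps)
    have "128 * r\<^sup>2 * (real (card S))\<^sup>2 * lam = 1"
      using n pre C z' by (simp add: lam_def D_def r_def y_def n_def field_simps power2_eq_square)
    from spectral_distribution_le_folner[OF r lam this fol4]
    have N: "?N lam * sqrt (real (folner G S r)) \<le> 2 * exp 2" .
    have N_nonneg: "0 \<le> ?N lam" by (simp add: spectral_distribution_eq)
    have "(F z)\<^sup>2 = sqrt (((F z)\<^sup>2)\<^sup>2)" by (simp only: real_sqrt_abs abs_power2)
    also have "\<dots> \<le> sqrt (C\<^sub>0 * real (folner G S r))" using Fy fol by (intro real_sqrt_le_mono) linarith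
    also have "\<dots> = sqrt C\<^sub>0 * sqrt (real (folner G S r))" by (rule real_sqrt_mult)
    finally have "?N lam * (F z)\<^sup>2 \<le> ?N lam * (sqrt C\<^sub>0 * sqrt (real (folner G S r)))"
      using N_nonneg by (rule mult_left_mono)
    also have "\<dots> = sqrt C\<^sub>0 * (?N lam * sqrt (real (folner G S r)))" by simp
    also have "\<dots> \<le> sqrt C\<^sub>0 * (2 * exp 2)" using N pre by (intro mult_left_mono) auto
    \<comment> \<open>One of the two factors \<open>F z\<close> absorbs the constants; the other one
      gives the claim.\<close>
    also have "\<dots> \<le> F z" using K(3) Fz(1) by (simp add: mult.commute)
    finally have "(?N lam * F z) * F z \<le> 1 * F z" by (simp add: power2_eq_square)
    then have "?N lam * F z \<le> 1" using Fz by (subst (asm) mult_le_cancel_right_pos) auto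
    then show ?thesis using Fz by (simp add: lam_def[symmetric] field_simps)
  qed
  have Z: "1 \<le> Z" by (simp add: Z_def)
  show ?thesis
    unfolding dil_preceq_at_zero_def
  proof (rule exI[of _ D], rule conjI[OF D], rule exI[of _ "1 / (D * Z\<^sup>2)"], intro conjI ballI)
    show "0 < 1 / (D * Z\<^sup>2)" using D Z by simp
    fix lam assume lam: "lam \<in> {0..<1 / (D * Z\<^sup>2)}"
    show "?N lam \<le> (if D * lam = 0 then 0 else 1 / F ((D * lam) powr (-1/2)))"
    proof (cases "lam = 0")
      case True
      \<comment> \<open>At \<open>lam = 0\<close> the right-hand side is 0 by convention, so
        \<open>?N 0\<close> has to vanish: by monotonicity it lies below \<open>1 / F z\<close> for
        all large \<open>z\<close>.\<close>
      have "((\<lambda>z. 1 / F z) \<longlongrightarrow> 0) at_top"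
        by (rule tendsto_divide_0[OF tendsto_const filterlim_at_top_imp_at_infinity[OF assms(11)]])
      moreover have "\<forall>\<^sub>F z in at_top. ?N 0 \<le> 1 / F z"
        using eventually_ge_at_top[of Z]
      proof eventually_elim
        case (elim z)
        have "?N 0 \<le> ?N (1 / (D * z\<^sup>2))" using D by (intro spectral_distribution_mono) simp
        with key[OF elim] show ?case by linarith
      qed
      ultimately have "?N 0 \<le> 0" by (rule tendsto_lowerbound) simp
      with True show ?thesis by simp
    next
      case False
      then have pos: "0 < D * lam" using lam D by simp
      \<comment> \<open>This \<open>z\<close> solves \<open>lam = 1 / (D * z\<^sup>2)\<close>, and
        the bound on \<open>lam\<close> gives \<open>Z \<le> z\<close>.\<close>
      define z where "z = (D * lam) powr (-1/2)"
      have z: "z = 1 / sqrt (D * lam)"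
        using pos by (simp add: z_def powr_minus powr_half_sqrt field_simps)
      have "Z\<^sup>2 * (D * lam) \<le> 1" using lam D Z by (simp add: field_simps)
      then have "sqrt (Z\<^sup>2 * (D * lam)) \<le> 1" by simp
      then have "Z * sqrt (D * lam) \<le> 1" using Z by (simp add: real_sqrt_mult)
      then have "Z \<le> z" using pos by (simp add: z field_simps)
      moreover have "1 / (D * z\<^sup>2) = lam" using pos D by (simp add: z power_divide)
      ultimately show ?thesis using key[of z] False D by (simp add: z_def)
    qed
  qed
qed

end
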